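(* Let $u$ and $u'$ be two good elements in a $\mathsf\Lambda$-upper cluster algebra $\mathcal U$. If $(u\mid\mid u')_F=0$, then the tropical points $\{\mathbf g_u^t\}_{t\in\mathbb T_n}$ and $\{\mathbf g_{u'}^t\}_{t\in\mathbb T_n}$ corresponding to $u$ and $u'$ are sign-coherent, and the product $uu'$ is still a good element in $\mathcal U$.
   Context: Fix integers $m\ge n>0$; $[1,r]=\{1,\dots,r\}$, $[a]_+=\max\{a,0\}$. Vectors are columns; matrices are integral. Seeds. A mutation matrix is an $m\times n$ matrix $\widetilde B=(b_{ij})$ whose top $n\times n$ block $B$ is skew-symmetrizable (there is a diagonal matrix $S$ with positive integer diagonal entries such that $SB$ is skew-symmetric). For $k\in[1,n]$, $\mu_k(\widetilde B)=(b'_{ij})$ with $b'_{ij}=-b_{ij}$ if $i=k$ or $j=k$, and $b'_{ij}=b_{ij}+[b_{ik}]_+[b_{kj}]_+-[-b_{ik}]_+[-b_{kj}]_+$ otherwise. Let $\mathbb F$ be the field of rational functions over $\mathbb Q$ in $m$ variables. A seed is $(\mathbf x,\widetilde B)$ with $\mathbf x=(x_1,\dots,x_m)$ a free generating set of $\mathbb F$ over $\mathbb Q$ and $\widetilde B$ a mutation matrix. Its mutation $\mu_k(\mathbf x,\widetilde B)=(\mathbf x',\mu_k(\widetilde B))$ has $x_i'=x_i$ for $i\ne k$ and $x_kx_k'=\prod_jx_j^{[b_{jk}]_+}+\prod_jx_j^{[-b_{jk}]_+}$. $\mathbb T_n$ is the $n$-regular tree with edges labelled by $1,\dots,n$ so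 that the edges at each vertex have distinct labels, with root $t_0$. A cluster pattern assigns to each $t\in\mathbb T_n$ a seed $(\mathbf x_t,\widetilde B_t)$, with seeds at the ends of an edge labelled $k$ related by $\mu_k$. Write $\mathbf x_t=(x_{1;t},\dots,x_{m;t})$, $\widetilde B_t=(b_{ij;t})$, $\hat y_{k;t}=\prod_{j=1}^mx_{j;t}^{b_{jk;t}}$. The upper cluster algebra is $\mathcal U=\bigcap_{t}\mathbb Z[x_{1;t}^{\pm1},\dots,x_{m;t}^{\pm1}]$. $\mathsf\Lambda$-structure. $(\widetilde B,\Lambda)$, $\Lambda$ an $m\times m$ skew-symmetric integer matrix, is a compatible pair of type $S=\mathrm{diag}(s_1,\dots,s_n)$ ($s_i\in\mathbb Z_{>0}$) if $\widetilde B^T\Lambda=(S\mid\mathbf 0)$, $\mathbf 0$ the $n\times(m-n)$ zero matrix. Its mutation in direction $k$ is $(\mu_k(\widetilde B),E^T\Lambda E)$, where $E$ is $I_m$ with $k$th column replaced by the column with entries $e_k=-1$, $e_i=[-\varepsilon b_{ik}]_+$ ($i\ne k$), $\varepsilon\in\{\pm1\}$ (independent of $\varepsilon$). $\mathcal U$ is a $\mathsf\Lambda$-upper cluster algebra if it is given with skew-symmetric matrices $\Lambda_t$, $t\in\mathbb T_n$, such that each $(\widetilde B_t,\Lambda_t)$ is a compatible pair and pairs at the ends of an edge labelled $k$ are related by mutation in direction $k$ (all are then of the same type $S$, and all $\widetilde B_t$ have rank $n$). Good elements. A tropical point is a family $\{\mathbf g^t\in\mathbb Z^m\mid t\in\mathbb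 T_n\}$ such that for every edge labelled $k$ between $t$ and $t'$: $g_k^{t'}=-g_k^t$ and $g_i^{t'}=g_i^t+[-b_{ik;t}]_+g_k^t+b_{ik;t}[g_k^t]_+$ for $i\ne k$. An element $u\in\mathcal U$ is pointed at $t$ if $u=\mathbf x_t^{\mathbf g_u^t}F_u^t(\hat y_{1;t},\dots,\hat y_{n;t})$ with $\mathbf g_u^t\in\mathbb Z^m$ and $F_u^t\in\mathbb Z[y_1,\dots,y_n]$ with constant term $1$ (these are then unique). $u$ is good if it is pointed at every $t$, $\{\mathbf g_u^t\}_t$ is a tropical point (the tropical point corresponding to $u$), and $u\in\mathbb Z_{\ge0}[x_{1;t}^{\pm1},\dots,x_{m;t}^{\pm1}]$ for all $t$. Two tropical points $\{\mathbf g^t\}$, $\{\mathbf g'^{\,t}\}$ are sign-coherent if $g_k^t\cdot g_k'^{\,t}\ge0$ for all $t\in\mathbb T_n$ and all $k\in[1,n]$. $F$-invariant. Let $\mathbb Z^{\max}=(\mathbb Z,+,\max)$ and let $\mathbb F_{>0}=\mathbb Q_{\rm sf}(x_{1;t_0},\dots,x_{m;t_0})$ be the semifield of nonzero rational functions with subtraction-free expressions. For a good element $u$ there is a unique semifield homomorphism $\beta_u:\mathbb F_{>0}\to\mathbb Z^{\max}$ with $(\beta_u(x_{1;t}),\dots,\beta_u(x_{m;t}))=(\Lambda_t\mathbf g_u^t)^T$ for all $t\in\mathbb T_n$. For good $u,u'$, $(u\mid\mid u')_F:=\beta_{u'}(u)+\beta_u(u')$. *)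

theory Defs
  imports
    Complex_Main
    "HOL-Library.FuncSet"
    "HOL-Library.Poly_Mapping"
    "Jordan_Normal_Form.Matrix"
begin

text \<open>
  Indices start at 0: the index sets \<open>[1,m]\<close> and \<open>[1,n]\<close> of the usual notation
  become \<open>{..<m}\<close> and \<open>{..<n}\<close>.
\<close>

definition pos_part :: "int \<Rightarrow> int" (\<open>[_]\<^sub>+\<close>) where
  "[a]\<^sub>+ = max a 0"


section \<open>Polynomials, Laurent polynomials and free generating sets\<close>

text \<open>
  A polynomial with coefficients in \<open>'c\<close> is a finitely supported map from exponents
  (finitely supported maps from variable indices to powers) to coefficients; \<open>h\<close> embeds
  the coefficients into the ring in which the polynomial is evaluated.
\<close>

definition mpoly_in :: "nat \<Rightarrow> ((nat \<Rightarrow>\<^sub>0 nat) \<Rightarrow>\<^sub>0 'c::zero) \<Rightarrow> bool" where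
  "mpoly_in r p \<longleftrightarrow> (\<forall>\<alpha>\<in>Poly_Mapping.keys p. Poly_Mapping.keys \<alpha> \<subseteq> {..<r})"

definition mpoly_eval ::
  "('c::zero \<Rightarrow> 'a::comm_ring_1) \<Rightarrow> (nat \<Rightarrow> 'a) \<Rightarrow> ((nat \<Rightarrow>\<^sub>0 nat) \<Rightarrow>\<^sub>0 'c) \<Rightarrow> 'a" where
  "mpoly_eval h f p =
     (\<Sum>\<alpha>\<in>Poly_Mapping.keys p.
        h (Poly_Mapping.lookup p \<alpha>) * (\<Prod>i\<in>Poly_Mapping.keys \<alpha>. f i ^ Poly_Mapping.lookup \<alpha> i))"

definition laurent_monom :: "'a::field vec \<Rightarrow> int vec \<Rightarrow> 'a" where
  "laurent_monom x g = (\<Prod>i<dim_vec x. x $ i powi g $ i)"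

text \<open>Laurent polynomials in \<open>x\<close> all of whose coefficients lie in \<open>C\<close>.\<close>

definition laurent_polys :: "int set \<Rightarrow> 'a::field vec \<Rightarrow> 'a set" where
  "laurent_polys C x =
     {(\<Sum>g\<in>G. of_int (c g) * laurent_monom x g) | G c.
        finite G \<and> G \<subseteq> carrier_vec (dim_vec x) \<and> (\<forall>g\<in>G. c g \<in> C)}"

definition is_subfield :: "'a::field set \<Rightarrow> bool" where
  "is_subfield K \<longleftrightarrow>
     0 \<in> K \<and> 1 \<in> K \<and> (\<forall>a\<in>K. \<forall>b\<in>K. a - b \<in> K \<and> a * b \<in> K) \<and> (\<forall>a\<in>K. inverse a \<in> K)"

definition alg_independent :: "'a::field_char_0 vec \<Rightarrow> bool" where
  "alg_independent x \<longleftrightarrow>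
     (\<forall>p. mpoly_in (dim_vec x) p \<and> mpoly_eval of_rat (($) x) p = 0 \<longrightarrow> p = 0)"

text \<open>
  The field of rational functions in \<open>m\<close> variables over the rationals is taken up to
  isomorphism, as a subfield \<open>F\<close> of an arbitrary field of characteristic 0: \<open>F\<close> is such a
  field exactly if it has a free generating set of size \<open>m\<close>.  The rationals are contained
  in every subfield, so the hull below is the field obtained from them by adjoining the
  entries of \<open>x\<close>.
\<close>

definition free_generating_set :: "nat \<Rightarrow> 'a::field_char_0 set \<Rightarrow> 'a vec \<Rightarrow> bool" where
  "free_generating_set m F x \<longleftrightarrow>
     x \<in> carrier_vec m \<and> alg_independent x \<and> is_subfield hull (set\<^sub>v x) = F"


section \<open>Seeds, cluster patterns and upper cluster algebras\<close>

definition skew_symmetric :: "int mat \<Rightarrow> bool" where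
  "skew_symmetric A \<longleftrightarrow> square_mat A \<and> transpose_mat A = - A"

definition skew_symmetrizable :: "int mat \<Rightarrow> bool" where
  "skew_symmetrizable A \<longleftrightarrow>
     square_mat A \<and> (\<exists>s. (\<forall>i<dim_row A. s i > 0) \<and> skew_symmetric (mat_diag (dim_row A) s * A))"

definition mutation_matrix :: "nat \<Rightarrow> nat \<Rightarrow> int mat \<Rightarrow> bool" where
  "mutation_matrix m n B \<longleftrightarrow>
     B \<in> carrier_mat m n \<and> skew_symmetrizable (mat n n (\<lambda>(i,j). B $$ (i,j)))"

definition mutate_mat :: "nat \<Rightarrow> int mat \<Rightarrow> int mat" where
  "mutate_mat k B = mat (dim_row B) (dim_col B) (\<lambda>(i,j).
     if i = k \<or> j = k then - B $$ (i,j)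
     else B $$ (i,j) + [B $$ (i,k)]\<^sub>+ * [B $$ (k,j)]\<^sub>+ - [- B $$ (i,k)]\<^sub>+ * [- B $$ (k,j)]\<^sub>+)"

definition seed :: "nat \<Rightarrow> nat \<Rightarrow> 'a::field_char_0 set \<Rightarrow> 'a vec \<times> int mat \<Rightarrow> bool" where
  "seed m n F = (\<lambda>(x, B). free_generating_set m F x \<and> mutation_matrix m n B)"

text \<open>Division by the \<open>k\<close>-th variable is harmless: it is nonzero in every seed.\<close>

definition mutate_seed :: "nat \<Rightarrow> 'a::field vec \<times> int mat \<Rightarrow> 'a vec \<times> int mat" where
  "mutate_seed k = (\<lambda>(x, B).
     (vec (dim_vec x) (\<lambda>i.
        if i = k
        then ((\<Prod>j<dim_vec x. x $ j powi [B $$ (j,k)]\<^sub>+) + (\<Prod>j<dim_vec x. x $ j powi [- B $$ (j,k)]\<^sub>+)) / x $ k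
        else x $ i),
      mutate_mat k B))"

text \<open>
  The \<open>n\<close>-regular tree with edge labels \<open>{..<n}\<close>: a vertex is the sequence of edge labels
  (last edge first) on the path leading to it from the root \<open>[]\<close>; these are exactly the words
  without two equal adjacent letters.
\<close>

definition tree_vertices :: "nat \<Rightarrow> nat list set" where
  "tree_vertices n = {t. set t \<subseteq> {..<n} \<and> distinct_adj t}"

definition tree_edge :: "nat \<Rightarrow> nat \<Rightarrow> nat list \<Rightarrow> nat list \<Rightarrow> bool" where
  "tree_edge n k t t' \<longleftrightarrow>
     t \<in> tree_vertices n \<and> t' \<in> tree_vertices n \<and> (t' = k # t \<or> t = k # t')"

definition cluster_pattern ::
  "nat \<Rightarrow> nat \<Rightarrow> 'a::field_char_0 set \<Rightarrow> (nat list \<Rightarrow> 'a vec) \<Rightarrow> (nat list \<Rightarrow> int mat) \<Rightarrow> bool" where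
  "cluster_pattern m n F x B \<longleftrightarrow>
     (\<forall>t\<in>tree_vertices n. seed m n F (x t, B t)) \<and>
     (\<forall>k t t'. tree_edge n k t t' \<longrightarrow> (x t', B t') = mutate_seed k (x t, B t))"

definition upper_cluster_algebra :: "nat \<Rightarrow> (nat list \<Rightarrow> 'a::field vec) \<Rightarrow> 'a set" where
  "upper_cluster_algebra n x = (\<Inter>t\<in>tree_vertices n. laurent_polys UNIV (x t))"


section \<open>Compatible pairs\<close>

definition compatible_pair ::
  "nat \<Rightarrow> nat \<Rightarrow> (nat \<Rightarrow> int) \<Rightarrow> int mat \<Rightarrow> int mat \<Rightarrow> bool" where
  "compatible_pair m n s B \<Lambda> \<longleftrightarrow>
     B \<in> carrier_mat m n \<and> \<Lambda> \<in> carrier_mat m m \<and> skew_symmetric \<Lambda> \<and> (\<forall>i<n. s i > 0) \<and>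
     transpose_mat B * \<Lambda> = mat n m (\<lambda>(i,j). if i = j then s i else 0)"

definition mutation_E :: "int \<Rightarrow> nat \<Rightarrow> int mat \<Rightarrow> int mat" where
  "mutation_E \<epsilon> k B = mat (dim_row B) (dim_row B) (\<lambda>(i,j).
     if j = k then (if i = k then - 1 else [- \<epsilon> * B $$ (i,k)]\<^sub>+)
     else (if i = j then 1 else 0))"

definition mutate_pair :: "int \<Rightarrow> nat \<Rightarrow> int mat \<times> int mat \<Rightarrow> int mat \<times> int mat" where
  "mutate_pair \<epsilon> k = (\<lambda>(B, \<Lambda>).
     (mutate_mat k B, transpose_mat (mutation_E \<epsilon> k B) * \<Lambda> * mutation_E \<epsilon> k B))"

text \<open>
  For a compatible pair the mutation does not depend on the sign \<open>\<epsilon>\<close>, so it does not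
  matter that \<open>\<epsilon>\<close> is quantified existentially below.
\<close>

definition lambda_upper_cluster_algebra ::
  "nat \<Rightarrow> nat \<Rightarrow> 'a::field_char_0 set \<Rightarrow> (nat list \<Rightarrow> 'a vec) \<Rightarrow> (nat list \<Rightarrow> int mat) \<Rightarrow>
   (nat list \<Rightarrow> int mat) \<Rightarrow> bool" where
  "lambda_upper_cluster_algebra m n F x B \<Lambda> \<longleftrightarrow>
     cluster_pattern m n F x B \<and>
     (\<forall>t\<in>tree_vertices n. \<exists>s. compatible_pair m n s (B t) (\<Lambda> t)) \<and>
     (\<forall>k t t'. tree_edge n k t t' \<longrightarrow>
        (\<exists>\<epsilon>\<in>{1, - 1}. (B t', \<Lambda> t') = mutate_pair \<epsilon> k (B t, \<Lambda> t)))"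


section \<open>Tropical points and good elements\<close>

definition tropical_point ::
  "nat \<Rightarrow> nat \<Rightarrow> (nat list \<Rightarrow> int mat) \<Rightarrow> (nat list \<Rightarrow> int vec) \<Rightarrow> bool" where
  "tropical_point m n B g \<longleftrightarrow>
     (\<forall>t\<in>tree_vertices n. g t \<in> carrier_vec m) \<and>
     (\<forall>k t t'. tree_edge n k t t' \<longrightarrow>
        g t' $ k = - g t $ k \<and>
        (\<forall>i<m. i \<noteq> k \<longrightarrow>
           g t' $ i = g t $ i + [- B t $$ (i,k)]\<^sub>+ * g t $ k + B t $$ (i,k) * [g t $ k]\<^sub>+))"

definition sign_coherent :: "nat \<Rightarrow> (nat list \<Rightarrow> int vec) \<Rightarrow> (nat list \<Rightarrow> int vec) \<Rightarrow> bool" where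
  "sign_coherent n g g' \<longleftrightarrow> (\<forall>t\<in>tree_vertices n. \<forall>k<n. g t $ k * g' t $ k \<ge> 0)"

definition y_hat :: "'a::field vec \<Rightarrow> int mat \<Rightarrow> nat \<Rightarrow> 'a" where
  "y_hat x B k = laurent_monom x (col B k)"

text \<open>\<open>u\<close> is pointed at the seed \<open>(x, B)\<close> with g-vector \<open>g\<close> and F-polynomial \<open>P\<close>.\<close>

definition pointed_with ::
  "'a::field vec \<Rightarrow> int mat \<Rightarrow> 'a \<Rightarrow> int vec \<Rightarrow> ((nat \<Rightarrow>\<^sub>0 nat) \<Rightarrow>\<^sub>0 int) \<Rightarrow> bool" where
  "pointed_with x B u g P \<longleftrightarrow>
     g \<in> carrier_vec (dim_vec x) \<and> mpoly_in (dim_col B) P \<and> Poly_Mapping.lookup P 0 = 1 \<and>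
     u = laurent_monom x g * mpoly_eval of_int (y_hat x B) P"

definition pointed :: "'a::field vec \<Rightarrow> int mat \<Rightarrow> 'a \<Rightarrow> bool" where
  "pointed x B u \<longleftrightarrow> (\<exists>g P. pointed_with x B u g P)"

definition g_vector :: "'a::field vec \<Rightarrow> int mat \<Rightarrow> 'a \<Rightarrow> int vec" where
  "g_vector x B u = (THE g. \<exists>P. pointed_with x B u g P)"

definition g_family ::
  "(nat list \<Rightarrow> 'a::field vec) \<Rightarrow> (nat list \<Rightarrow> int mat) \<Rightarrow> 'a \<Rightarrow> nat list \<Rightarrow> int vec" where
  "g_family x B u = (\<lambda>t. g_vector (x t) (B t) u)"

definition good ::
  "nat \<Rightarrow> nat \<Rightarrow> (nat list \<Rightarrow> 'a::field vec) \<Rightarrow> (nat list \<Rightarrow> int mat) \<Rightarrow> 'a \<Rightarrow> bool" where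
  "good m n x B u \<longleftrightarrow>
     u \<in> upper_cluster_algebra n x \<and>
     (\<forall>t\<in>tree_vertices n. pointed (x t) (B t) u) \<and>
     tropical_point m n B (g_family x B u) \<and>
     (\<forall>t\<in>tree_vertices n. u \<in> laurent_polys {0..} (x t))"


section \<open>The F-invariant\<close>

text \<open>
  The elements with a subtraction-free expression in the elements of \<open>X\<close>.  In the application
  \<open>X\<close> is a nonempty set of algebraically independent elements; then 0 is not
  obtained and every positive rational is.
\<close>

inductive_set subtraction_free :: "'a::field set \<Rightarrow> 'a set" for X where
  base: "a \<in> X \<Longrightarrow> a \<in> subtraction_free X"
| add: "a \<in> subtraction_free X \<Longrightarrow> b \<in> subtraction_free X \<Longrightarrow> a + b \<in> subtraction_free X"
| mult: "a \<in> subtraction_free X \<Longrightarrow> b \<in> subtraction_free X \<Longrightarrow> a * b \<in> subtraction_free X"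
| divide: "a \<in> subtraction_free X \<Longrightarrow> b \<in> subtraction_free X \<Longrightarrow> a / b \<in> subtraction_free X"

text \<open>
  Semifield homomorphisms from \<open>P\<close> to the integers with \<open>+\<close> as multiplication and \<open>max\<close> as
  addition.  They are made extensional (\<open>undefined\<close> outside \<open>P\<close>) so that uniqueness
  on \<open>P\<close> is uniqueness as a HOL function.
\<close>

definition max_plus_hom :: "'a::field set \<Rightarrow> ('a \<Rightarrow> int) \<Rightarrow> bool" where
  "max_plus_hom P \<beta> \<longleftrightarrow>
     \<beta> \<in> extensional P \<and>
     (\<forall>a\<in>P. \<forall>b\<in>P. \<beta> (a * b) = \<beta> a + \<beta> b \<and> \<beta> (a + b) = max (\<beta> a) (\<beta> b))"

definition beta ::
  "nat \<Rightarrow> (nat list \<Rightarrow> 'a::field vec) \<Rightarrow> (nat list \<Rightarrow> int mat) \<Rightarrow> (nat list \<Rightarrow> int mat) \<Rightarrow> 'a \<Rightarrow>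
   'a \<Rightarrow> int" where
  "beta n x B \<Lambda> u = (THE \<beta>.
     max_plus_hom (subtraction_free (set\<^sub>v (x []))) \<beta> \<and>
     (\<forall>t\<in>tree_vertices n. map_vec \<beta> (x t) = \<Lambda> t *\<^sub>v g_family x B u t))"

definition F_invariant ::
  "nat \<Rightarrow> (nat list \<Rightarrow> 'a::field vec) \<Rightarrow> (nat list \<Rightarrow> int mat) \<Rightarrow> (nat list \<Rightarrow> int mat) \<Rightarrow> 'a \<Rightarrow>
   'a \<Rightarrow> int" where
  "F_invariant n x B \<Lambda> u u' = beta n x B \<Lambda> u' u + beta n x B \<Lambda> u u'"

end

theory Submission
  imports Defs
begin

text \<open>
  At every vertex \<open>t\<close> the element \<open>u\<close> has a Laurent expansion with nonnegative coefficients in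
  which the leading monomial, with exponent \<open>g\<^sub>u\<close>, has coefficient 1.  Hence
  \<open>\<beta>\<^sub>u\<^sub>'(u) \<ge> g\<^sub>u \<bullet> \<Lambda>\<^sub>t g\<^sub>u\<^sub>'\<close>, and likewise with \<open>u\<close> and \<open>u'\<close> exchanged.  The two lower bounds
  add up to 0 because \<open>\<Lambda>\<^sub>t\<close> is skew-symmetric, so if the F-invariant vanishes, then the pairing
  \<open>g\<^sub>u \<bullet> \<Lambda>\<^sub>t g\<^sub>u\<^sub>'\<close> equals \<open>\<beta>\<^sub>u\<^sub>'(u)\<close> for all \<open>t\<close>.  Along an edge labelled \<open>k\<close> this pairing changes
  by a nonzero multiple of the product of the \<open>k\<close>-th entries if these have opposite signs and
  is unchanged otherwise, whence sign-coherence.  Pointwise sums of sign-coherent tropical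
  points are tropical points, so the product is good.
\<close>

section \<open>Evaluation of polynomials\<close>

text \<open>Names the monomial factor in \<open>mpoly_eval\<close>, so that its multiplicativity in
  the exponent can be stated.\<close>

definition power_product :: "(nat \<Rightarrow> 'a::comm_ring_1) \<Rightarrow> (nat \<Rightarrow>\<^sub>0 nat) \<Rightarrow> 'a" where
  "power_product f \<alpha> = (\<Prod>i\<in>Poly_Mapping.keys \<alpha>. f i ^ Poly_Mapping.lookup \<alpha> i)"

text \<open>Additional indices contribute factors with exponent 0. This allows two exponents with
  different supports to be compared over one index set.\<close>

lemma power_product_superset:
  assumes "finite I" and "Poly_Mapping.keys \<alpha> \<subseteq> I"
  shows "power_product f \<alpha> = (\<Prod>i\<in>I. f i ^ Poly_Mapping.lookup \<alpha> i)"
  unfolding power_product_def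
  by (rule prod.mono_neutral_left) (use assms in \<open>auto simp: in_keys_iff\<close>)

lemma power_product_add: "power_product f (\<alpha> + \<beta>) = power_product f \<alpha> * power_product f \<beta>"
proof -
  let ?I = "Poly_Mapping.keys \<alpha> \<union> Poly_Mapping.keys \<beta>"
  have "Poly_Mapping.keys (\<alpha> + \<beta>) \<subseteq> ?I"
    by (rule keys_add)
  then show ?thesis
    by (simp add: power_product_superset[of ?I] lookup_add power_add prod.distrib)
qed

lemma mpoly_eval_superset:
  assumes "h 0 = 0" and "finite A" and "Poly_Mapping.keys p \<subseteq> A"
  shows "mpoly_eval h f p = (\<Sum>\<alpha>\<in>A. h (Poly_Mapping.lookup p \<alpha>) * power_product f \<alpha>)"
  unfolding mpoly_eval_def power_product_def
  by (rule sum.mono_neutral_left) (use assms in \<open>auto simp: in_keys_iff\<close>)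

lemma mpoly_eval_zero [simp]: "mpoly_eval h f 0 = 0"
  by (simp add: mpoly_eval_def)

lemma mpoly_eval_add:
  assumes "h 0 = 0" and "\<And>a b. h (a + b) = h a + h b"
  shows "mpoly_eval h f (p + q) = mpoly_eval h f p + mpoly_eval h f q"
proof -
  let ?A = "Poly_Mapping.keys p \<union> Poly_Mapping.keys q"
  have "Poly_Mapping.keys (p + q) \<subseteq> ?A"
    by (rule keys_add)
  then show ?thesis
    using assms
    by (simp add: mpoly_eval_superset[where A = ?A] lookup_add algebra_simps sum.distrib)
qed

lemma mpoly_eval_sum:
  assumes "h 0 = 0" and "\<And>a b. h (a + b) = h a + h b"
  shows "mpoly_eval h f (\<Sum>i\<in>I. p i) = (\<Sum>i\<in>I. mpoly_eval h f (p i))"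
  by (induction I rule: infinite_finite_induct) (simp_all add: mpoly_eval_add[of h, OF assms])

lemma mpoly_eval_single:
  assumes "h 0 = 0"
  shows "mpoly_eval h f (Poly_Mapping.single \<alpha> c) = h c * power_product f \<alpha>"
  using mpoly_eval_superset[of h "{\<alpha>}" "Poly_Mapping.single \<alpha> c" f] assms by simp

lemma poly_mapping_sum_singles:
  "p = (\<Sum>\<alpha>\<in>Poly_Mapping.keys p. Poly_Mapping.single \<alpha> (Poly_Mapping.lookup p \<alpha>))"
  by (rule poly_mapping_eqI)
     (auto simp: lookup_sum lookup_single when_def in_keys_iff)

text \<open>Both factors are split into single terms. On products of single terms the claim is
  multiplicativity of \<open>h\<close> and of \<open>power_product\<close>.\<close>

lemma mpoly_eval_mult:
  fixes h :: "'c::comm_ring_1 \<Rightarrow> 'a::comm_ring_1"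
  assumes h: "h 0 = 0" "\<And>a b. h (a + b) = h a + h b" and mult: "\<And>a b. h (a * b) = h a * h b"
  shows "mpoly_eval h f (p * q) = mpoly_eval h f p * mpoly_eval h f q"
proof -
  let ?s = "\<lambda>p \<alpha>. Poly_Mapping.single \<alpha> (Poly_Mapping.lookup p \<alpha>)"
  have "p * q = (\<Sum>\<alpha>\<in>Poly_Mapping.keys p. ?s p \<alpha>) * (\<Sum>\<beta>\<in>Poly_Mapping.keys q. ?s q \<beta>)"
    using poly_mapping_sum_singles[of p] poly_mapping_sum_singles[of q] by simp
  also have "\<dots> = (\<Sum>\<alpha>\<in>Poly_Mapping.keys p. \<Sum>\<beta>\<in>Poly_Mapping.keys q.
      Poly_Mapping.single (\<alpha> + \<beta>) (Poly_Mapping.lookup p \<alpha> * Poly_Mapping.lookup q \<beta>))"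
    by (simp add: sum_product mult_single)
  finally have eq: "p * q = \<dots>" .
  show ?thesis
    unfolding eq mpoly_eval_superset[of h _ p, OF h(1) finite_keys subset_refl]
      mpoly_eval_superset[of h _ q, OF h(1) finite_keys subset_refl] mpoly_eval_sum[of h, OF h]
    by (simp add: mpoly_eval_single[of h, OF h(1)] power_product_add mult sum_product mult_ac)
qed

lemma mpoly_in_mult:
  assumes "mpoly_in r p" and "mpoly_in r q"
  shows "mpoly_in r (p * q)"
  unfolding mpoly_in_def
proof
  fix \<gamma> assume "\<gamma> \<in> Poly_Mapping.keys (p * q)"
  then obtain \<alpha> \<beta> where "\<gamma> = \<alpha> + \<beta>" "\<alpha> \<in> Poly_Mapping.keys p" "\<beta> \<in> Poly_Mapping.keys q"
    using keys_mult[of p q] by auto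
  then show "Poly_Mapping.keys \<gamma> \<subseteq> {..<r}"
    using assms keys_add[of \<alpha> \<beta>] unfolding mpoly_in_def by blast
qed

text \<open>Exponents are natural numbers, so 0 decomposes only as 0 + 0. Hence a product of
  F-polynomials again has constant term 1.\<close>

lemma lookup_mult_zero:
  fixes p q :: "(nat \<Rightarrow>\<^sub>0 nat) \<Rightarrow>\<^sub>0 'c::comm_ring_1"
  shows "Poly_Mapping.lookup (p * q) 0 = Poly_Mapping.lookup p 0 * Poly_Mapping.lookup q 0"
proof -
  have zero: "0 = \<alpha> + \<beta> \<longleftrightarrow> \<beta> = 0 \<and> \<alpha> = 0" for \<alpha> \<beta> :: "nat \<Rightarrow>\<^sub>0 nat"
    by (auto simp: poly_mapping_eq_iff lookup_add fun_eq_iff)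
  have inner: "(\<Sum>\<beta>. Poly_Mapping.lookup q \<beta> when 0 = \<alpha> + \<beta>) = (Poly_Mapping.lookup q 0 when \<alpha> = 0)"
    for \<alpha> :: "nat \<Rightarrow>\<^sub>0 nat"
    unfolding zero by (cases "\<alpha> = 0") simp_all
  show ?thesis
    unfolding lookup_mult inner by (simp add: mult_when)
qed


section \<open>Laurent monomials in algebraically independent elements\<close>

lemma power_int_sum:
  fixes a :: "'a::field"
  assumes "a \<noteq> 0"
  shows "a powi (\<Sum>i\<in>I. f i) = (\<Prod>i\<in>I. a powi f i)"
  by (induction I rule: infinite_finite_induct) (use assms in \<open>simp_all add: power_int_add\<close>)

text \<open>Isolates the property of a single cluster that makes Laurent expansions in it
  unique.\<close>

locale independent_vec =
  fixes m :: nat and x :: "'a::field_char_0 vec"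
  assumes carrier: "x \<in> carrier_vec m" and indep: "alg_independent x"
begin

lemma dim [simp]: "dim_vec x = m"
  using carrier by simp

lemma nonzero: "x $ i \<noteq> 0" if "i < m"
proof
  assume "x $ i = 0"
  let ?p = "Poly_Mapping.single (Poly_Mapping.single i 1) (1::rat) :: (nat \<Rightarrow>\<^sub>0 nat) \<Rightarrow>\<^sub>0 rat"
  have "mpoly_in m ?p"
    using that by (simp add: mpoly_in_def)
  moreover have "mpoly_eval of_rat (($) x) ?p = 0"
    using \<open>x $ i = 0\<close> by (simp add: mpoly_eval_single power_product_def)
  ultimately have "?p = 0"
    using indep by (simp add: alg_independent_def)
  then show False
    by (metis lookup_single_eq lookup_zero one_neq_zero)
qed

lemma laurent_monom_zero: "laurent_monom x (0\<^sub>v m) = 1"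
  by (simp add: laurent_monom_def)

lemma laurent_monom_add:
  "laurent_monom x (g + h) = laurent_monom x g * laurent_monom x h" if "h \<in> carrier_vec m"
  using that nonzero by (simp add: laurent_monom_def power_int_add prod.distrib)

lemma laurent_monom_unit:
  assumes "i < m"
  shows "laurent_monom x (unit_vec m i) = x $ i"
proof -
  have "laurent_monom x (unit_vec m i) = (\<Prod>j<m. if i = j then x $ j else 1)"
    unfolding laurent_monom_def dim
    by (rule prod.cong) (use assms in \<open>auto simp: unit_vec_def\<close>)
  also have "\<dots> = x $ i"
    using assms by simp
  finally show ?thesis .
qed

text \<open>Exchanging the product over the columns of B with the product over its rows collects,
  for each x_i, the i-th entry of B \<alpha> as exponent.\<close>

lemma power_product_y_hat:
  assumes B: "B \<in> carrier_mat m n" and "Poly_Mapping.keys \<alpha> \<subseteq> {..<n}"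
  shows "power_product (y_hat x B) \<alpha> =
    laurent_monom x (B *\<^sub>v vec n (\<lambda>k. int (Poly_Mapping.lookup \<alpha> k)))"
proof -
  have "power_product (y_hat x B) \<alpha> = (\<Prod>k<n. y_hat x B k ^ Poly_Mapping.lookup \<alpha> k)"
    using assms(2) by (simp add: power_product_superset)
  also have "\<dots> = (\<Prod>k<n. \<Prod>i<m. x $ i powi (B $$ (i,k) * int (Poly_Mapping.lookup \<alpha> k)))"
    using B by (simp add: y_hat_def laurent_monom_def prod_power_distrib power_int_mult)
  also have "\<dots> = (\<Prod>i<m. x $ i powi (\<Sum>k<n. B $$ (i,k) * int (Poly_Mapping.lookup \<alpha> k)))"
    by (subst prod.swap) (simp add: power_int_sum nonzero)
  also have "\<dots> = laurent_monom x (B *\<^sub>v vec n (\<lambda>k. int (Poly_Mapping.lookup \<alpha> k)))"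
    using B by (auto simp: laurent_monom_def scalar_prod_def atLeast0LessThan intro!: prod.cong)
  finally show ?thesis .
qed

text \<open>
  After multiplication by a high power of all variables a vanishing Laurent polynomial becomes a
  vanishing polynomial.
\<close>

lemma laurent_monom_independent:
  assumes fin: "finite G" and G: "G \<subseteq> carrier_vec m"
    and zero: "(\<Sum>g\<in>G. of_int (c g) * laurent_monom x g) = 0"
    and "g \<in> G"
  shows "c g = 0"
proof -
  \<comment> \<open>N bounds all entries of all exponents in absolute value; the inserted 0 keeps
    the maximum meaningful when there are none.\<close>
  define N where "N = Max (insert 0 ((\<lambda>(g,i). \<bar>g $ i\<bar>) ` (G \<times> {..<m})))"
  have N: "g $ i + N \<ge> 0" if "g \<in> G" "i < m" for g i
  proof -
    have "\<bar>g $ i\<bar> \<le> N"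
      unfolding N_def by (rule Max_ge) (use fin that in \<open>auto intro!: image_eqI[of _ _ "(g,i)"]\<close>)
    then show ?thesis by linarith
  qed
  \<comment> \<open>Shifting by N gives exponents of a genuine polynomial. The value 0 from index m
    on keeps the support finite.\<close>
  define e where "e g = Abs_poly_mapping (\<lambda>i. if i < m then nat (g $ i + N) else 0)" for g
  have lookup_e: "Poly_Mapping.lookup (e g) i = (if i < m then nat (g $ i + N) else 0)" for g i
    unfolding e_def by (subst lookup_Abs_poly_mapping) auto
  have keys_e: "Poly_Mapping.keys (e g) \<subseteq> {..<m}" for g
    by (auto simp: in_keys_iff lookup_e split: if_splits)
  \<comment> \<open>Distinct exponents stay distinct, so terms of p do not merge and the coefficient
    of p at \<open>e g\<close> is \<open>c g\<close>.\<close>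
  have inj: "inj_on e G"
  proof (rule inj_onI)
    fix g h assume gh: "g \<in> G" "h \<in> G" "e g = e h"
    have "g $ i = h $ i" if "i < m" for i
      using arg_cong[OF gh(3), of "\<lambda>a. Poly_Mapping.lookup a i"] N[OF gh(1) that] N[OF gh(2) that] that
      by (simp add: lookup_e)
    then show "g = h"
      using gh G by (metis carrier_vecD eq_vecI subsetD)
  qed
  define p where "p = (\<Sum>g\<in>G. Poly_Mapping.single (e g) (of_int (c g) :: rat))"
  have keys_p: "Poly_Mapping.keys p \<subseteq> e ` G"
    unfolding p_def using keys_sum[of "\<lambda>g. Poly_Mapping.single (e g) (of_int (c g) :: rat)" G]
    by (fastforce split: if_splits)
  have "mpoly_in m p"
    unfolding mpoly_in_def using keys_p keys_e by blast
  have shift: "power_product (($) x) (e g) = (\<Prod>i<m. x $ i powi N) * laurent_monom x g" if "g \<in> G" for g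
  proof -
    have "power_product (($) x) (e g) = (\<Prod>i<m. x $ i powi (N + g $ i))"
      using N[OF that] keys_e
      by (auto simp: power_product_superset[of "{..<m}"] lookup_e power_int_def add.commute intro!: prod.cong)
    also have "\<dots> = (\<Prod>i<m. x $ i powi N) * laurent_monom x g"
      using nonzero by (simp add: laurent_monom_def power_int_add prod.distrib)
    finally show ?thesis .
  qed
  have "mpoly_eval of_rat (($) x) p = (\<Sum>g\<in>G. of_int (c g) * power_product (($) x) (e g))"
    unfolding p_def by (simp add: mpoly_eval_sum of_rat_add mpoly_eval_single)
  also have "\<dots> = (\<Prod>i<m. x $ i powi N) * (\<Sum>g\<in>G. of_int (c g) * laurent_monom x g)"
    by (simp add: shift sum_distrib_left mult_ac)
  finally have "mpoly_eval of_rat (($) x) p = 0"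
    using zero by simp
  with \<open>mpoly_in m p\<close> have "p = 0"
    using indep by (simp add: alg_independent_def)
  then have "0 = Poly_Mapping.lookup p (e g)"
    by simp
  also have "\<dots> = (\<Sum>h\<in>G. if h = g then of_int (c h) else 0)"
    unfolding p_def lookup_sum lookup_single when_def
    by (rule sum.cong) (use inj \<open>g \<in> G\<close> in \<open>auto dest: inj_onD\<close>)
  also have "\<dots> = of_int (c g)"
    using fin \<open>g \<in> G\<close> by simp
  finally show ?thesis by simp
qed

text \<open>Padding both coefficient families by 0 to the union of the supports turns the difference
  into a vanishing Laurent polynomial. The default 0 in the conclusion covers exponents that occur
  on one side only.\<close>

lemma laurent_coeffs_unique:
  assumes fin: "finite G" "finite H" and sub: "G \<subseteq> carrier_vec m" "H \<subseteq> carrier_vec m"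
    and eq: "(\<Sum>g\<in>G. of_int (c g) * laurent_monom x g) = (\<Sum>g\<in>H. of_int (d g) * laurent_monom x g)"
  shows "(if k \<in> G then c k else 0) = (if k \<in> H then d k else 0)"
proof (cases "k \<in> G \<union> H")
  case True
  let ?c = "\<lambda>k. if k \<in> G then c k else 0" and ?d = "\<lambda>k. if k \<in> H then d k else 0"
  have "(\<Sum>g\<in>G. of_int (c g) * laurent_monom x g) = (\<Sum>g\<in>G \<union> H. of_int (?c g) * laurent_monom x g)"
    by (rule sum.mono_neutral_cong_left) (use fin in auto)
  moreover have "(\<Sum>g\<in>H. of_int (d g) * laurent_monom x g) = (\<Sum>g\<in>G \<union> H. of_int (?d g) * laurent_monom x g)"
    by (rule sum.mono_neutral_cong_left) (use fin in auto)
  ultimately have "(\<Sum>g\<in>G \<union> H. of_int (?c g - ?d g) * laurent_monom x g) = 0"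
    using eq by (simp only: of_int_diff left_diff_distrib sum_subtractf) simp
  then have "?c k - ?d k = 0"
    using fin sub True by (intro laurent_monom_independent[of "G \<union> H" "\<lambda>k. ?c k - ?d k"]) auto
  then show ?thesis by simp
qed auto

end


section \<open>Rings of Laurent polynomials\<close>

context independent_vec
begin

text \<open>Coefficients are padded by 0 on the union of the supports, hence the closure conditions
  on C. They hold for all integers and for the nonnegative ones.\<close>

lemma laurent_polys_add:
  assumes C: "\<And>a b. a \<in> C \<Longrightarrow> b \<in> C \<Longrightarrow> a + b \<in> C" "0 \<in> C"
    and "a \<in> laurent_polys C x" and "b \<in> laurent_polys C x"
  shows "a + b \<in> laurent_polys C x"
proof -
  from assms(3,4) obtain G c H d where
    G: "finite G" "G \<subseteq> carrier_vec m" "\<forall>g\<in>G. c g \<in> C" "a = (\<Sum>g\<in>G. of_int (c g) * laurent_monom x g)"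
    and H: "finite H" "H \<subseteq> carrier_vec m" "\<forall>g\<in>H. d g \<in> C" "b = (\<Sum>g\<in>H. of_int (d g) * laurent_monom x g)"
    unfolding laurent_polys_def dim by blast
  let ?c = "\<lambda>k. if k \<in> G then c k else 0" and ?d = "\<lambda>k. if k \<in> H then d k else 0"
  have "a = (\<Sum>g\<in>G \<union> H. of_int (?c g) * laurent_monom x g)"
    unfolding G by (rule sum.mono_neutral_cong_left) (use G H in auto)
  moreover have "b = (\<Sum>g\<in>G \<union> H. of_int (?d g) * laurent_monom x g)"
    unfolding H by (rule sum.mono_neutral_cong_left) (use G H in auto)
  ultimately have "a + b = (\<Sum>g\<in>G \<union> H. of_int (?c g + ?d g) * laurent_monom x g)"
    by (simp only: of_int_add distrib_right sum.distrib)
  moreover have "\<forall>g\<in>G \<union> H. ?c g + ?d g \<in> C"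
    using G H C by simp
  ultimately show ?thesis
    unfolding laurent_polys_def dim using G(1,2) H(1,2)
    by (intro CollectI exI[of _ "G \<union> H"] exI[of _ "\<lambda>g. ?c g + ?d g"]) auto
qed

lemma laurent_polys_mult:
  assumes C: "\<And>a b. a \<in> C \<Longrightarrow> b \<in> C \<Longrightarrow> a + b \<in> C" "0 \<in> C" "\<And>a b. a \<in> C \<Longrightarrow> b \<in> C \<Longrightarrow> a * b \<in> C"
    and "a \<in> laurent_polys C x" and "b \<in> laurent_polys C x"
  shows "a * b \<in> laurent_polys C x"
proof -
  from assms(4,5) obtain G c H d where
    G: "finite G" "G \<subseteq> carrier_vec m" "\<forall>g\<in>G. c g \<in> C" "a = (\<Sum>g\<in>G. of_int (c g) * laurent_monom x g)"
    and H: "finite H" "H \<subseteq> carrier_vec m" "\<forall>g\<in>H. d g \<in> C" "b = (\<Sum>g\<in>H. of_int (d g) * laurent_monom x g)"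
    unfolding laurent_polys_def dim by blast
  have sum: "(\<Sum>i\<in>I. f i) \<in> laurent_polys C x" if "\<And>i. i \<in> I \<Longrightarrow> f i \<in> laurent_polys C x" "finite I"
    for I :: "int vec set" and f
    using that(2,1)
  proof (induction I rule: finite_induct)
    case empty
    show ?case
      unfolding laurent_polys_def by (auto intro!: exI[of _ "{}"])
  next
    case (insert i I)
    then show ?case by (simp add: laurent_polys_add[of C, OF C(1,2)])
  qed
  have product: "of_int (c g) * laurent_monom x g * (of_int (d h) * laurent_monom x h) \<in> laurent_polys C x"
    if "g \<in> G" "h \<in> H" for g h
  proof -
    have "of_int (c g) * laurent_monom x g * (of_int (d h) * laurent_monom x h) =
        (\<Sum>k\<in>{g + h}. of_int (c g * d h) * laurent_monom x k)"
      using that H(2) by (simp add: laurent_monom_add subset_iff)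
    moreover have "c g * d h \<in> C" "g + h \<in> carrier_vec m"
      using that G(2,3) H(2,3) C(3) by (auto intro!: add_carrier_vec)
    ultimately show ?thesis
      unfolding laurent_polys_def dim
      by (intro CollectI exI[of _ "{g + h}"] exI[of _ "\<lambda>_. c g * d h"]) simp
  qed
  show ?thesis
    unfolding G H sum_product by (intro sum product G(1) H(1))
qed

end


section \<open>Semifield homomorphisms to the tropical integers\<close>

text \<open>The induction starts at a single summand, because the empty sum 0 has in general no
  subtraction-free expression.\<close>

lemma max_plus_hom_sum:
  assumes "max_plus_hom (subtraction_free X) \<beta>" and "finite I" and "I \<noteq> {}"
    and "\<And>i. i \<in> I \<Longrightarrow> f i \<in> subtraction_free X"
  shows "sum f I \<in> subtraction_free X \<and> (\<forall>i\<in>I. \<beta> (f i) \<le> \<beta> (sum f I))"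
  using assms(2-4)
proof (induction I rule: finite_ne_induct)
  case (singleton i)
  then show ?case by simp
next
  case (insert i I)
  then have IH: "sum f I \<in> subtraction_free X" "\<forall>i\<in>I. \<beta> (f i) \<le> \<beta> (sum f I)" "f i \<in> subtraction_free X"
    by auto
  moreover have "\<beta> (f i + sum f I) = max (\<beta> (f i)) (\<beta> (sum f I))"
    using assms(1) IH unfolding max_plus_hom_def by blast
  ultimately show ?case
    using insert.hyps by (auto intro: subtraction_free.add simp: max_def)
qed

text \<open>Positive integer coefficients are tropically invisible: adding another copy of
  \<open>a\<close> takes the maximum of \<open>\<beta> a\<close> with itself.\<close>

lemma max_plus_hom_of_int_mult:
  assumes \<beta>: "max_plus_hom (subtraction_free X) \<beta>" and a: "a \<in> subtraction_free X" and "c > 0"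
  shows "of_int c * a \<in> subtraction_free X \<and> \<beta> (of_int c * a) = \<beta> a"
  using \<open>c > 0\<close>
proof (induction c rule: int_gr_induct)
  case base
  then show ?case using a by simp
next
  case (step c)
  have "of_int (c + 1) * a = of_int c * a + a"
    by (simp add: algebra_simps)
  then show ?case
    using \<beta> a step unfolding max_plus_hom_def by (simp add: subtraction_free.add)
qed

section \<open>Positive Laurent polynomials as lists of exponents\<close>

context independent_vec
begin

text \<open>Repetitions in the list encode positive integer coefficients. Addition becomes
  concatenation, and no cancellation can occur.\<close>

abbreviation monom_sum :: "int vec list \<Rightarrow> 'a" where
  "monom_sum gs \<equiv> \<Sum>g\<leftarrow>gs. laurent_monom x g"

lemma monom_sum_count:
  assumes "finite G" and "set gs \<subseteq> G"
  shows "monom_sum gs = (\<Sum>g\<in>G. of_int (int (count_list gs g)) * laurent_monom x g)"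
  using assms(2)
proof (induction gs)
  case (Cons a gs)
  have "(\<Sum>g\<in>G. of_int (int (count_list (a # gs) g)) * laurent_monom x g) =
      (\<Sum>g\<in>G. (if g = a then laurent_monom x g else 0) + of_int (int (count_list gs g)) * laurent_monom x g)"
    by (rule sum.cong) (auto simp: algebra_simps)
  then show ?case
    using Cons assms(1) by (simp add: sum.distrib)
qed simp

text \<open>The coefficient of a monomial is its multiplicity in the list, which is nonzero exactly
  on the members. So the value determines the support, and that is all the degree depends
  on.\<close>

lemma monom_sum_eq_imp_set_eq:
  assumes "set gs \<subseteq> carrier_vec m" and "set hs \<subseteq> carrier_vec m" and "monom_sum gs = monom_sum hs"
  shows "set gs = set hs"
proof (rule Set.set_eqI)
  fix k
  have "(if k \<in> set gs then int (count_list gs k) else 0) = (if k \<in> set hs then int (count_list hs k) else 0)"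
    using assms by (intro laurent_coeffs_unique) (simp_all add: monom_sum_count[OF finite_set order_refl])
  moreover have "count_list gs k \<noteq> 0 \<longleftrightarrow> k \<in> set gs" "count_list hs k \<noteq> 0 \<longleftrightarrow> k \<in> set hs"
    by (simp_all add: count_list_0_iff)
  ultimately show "k \<in> set gs \<longleftrightarrow> k \<in> set hs"
    by (auto split: if_splits)
qed

lemma monom_sum_nonzero:
  assumes "set gs \<subseteq> carrier_vec m" and "gs \<noteq> []"
  shows "monom_sum gs \<noteq> 0"
  using monom_sum_eq_imp_set_eq[of gs "[]"] assms by auto

definition list_mult :: "int vec list \<Rightarrow> int vec list \<Rightarrow> int vec list" where
  "list_mult gs hs = [g + h. g \<leftarrow> gs, h \<leftarrow> hs]"

lemma set_list_mult: "set (list_mult gs hs) = (\<lambda>(g,h). g + h) ` (set gs \<times> set hs)"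
  by (auto simp: list_mult_def)

lemma monom_sum_list_mult:
  assumes "set hs \<subseteq> carrier_vec m"
  shows "monom_sum (list_mult gs hs) = monom_sum gs * monom_sum hs"
proof (induction gs)
  case Nil
  then show ?case by (simp add: list_mult_def)
next
  case (Cons g gs)
  have "monom_sum (map (\<lambda>h. g + h) hs) = laurent_monom x g * monom_sum hs"
    using assms by (induction hs) (simp_all add: laurent_monom_add distrib_left)
  then show ?case
    using Cons by (simp add: list_mult_def distrib_right)
qed

text \<open>The max-plus evaluation of the Laurent polynomial at the point w; positive coefficients
  do not enter.\<close>

definition trop_degree :: "int vec \<Rightarrow> int vec list \<Rightarrow> int" where
  "trop_degree w gs = Max ((\<lambda>g. g \<bullet> w) ` set gs)"

lemma trop_degree_append:
  assumes "gs \<noteq> []" and "hs \<noteq> []"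
  shows "trop_degree w (gs @ hs) = max (trop_degree w gs) (trop_degree w hs)"
  using assms by (simp add: trop_degree_def image_Un Max_Un)

lemma trop_degree_list_mult:
  assumes "gs \<noteq> []" and "hs \<noteq> []" and "set gs \<subseteq> carrier_vec m" and "set hs \<subseteq> carrier_vec m"
    and w: "w \<in> carrier_vec m"
  shows "trop_degree w (list_mult gs hs) = trop_degree w gs + trop_degree w hs"
  unfolding trop_degree_def
proof (rule Max_eqI)
  have add: "(g + h) \<bullet> w = g \<bullet> w + h \<bullet> w" if "g \<in> set gs" "h \<in> set hs" for g h
    using assms that by (auto intro!: add_scalar_prod_distrib)
  show "a \<le> Max ((\<lambda>g. g \<bullet> w) ` set gs) + Max ((\<lambda>g. g \<bullet> w) ` set hs)"
    if "a \<in> (\<lambda>g. g \<bullet> w) ` set (list_mult gs hs)" for a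
    using that by (auto simp: set_list_mult add intro!: add_mono)
  \<comment> \<open>Members of maximal weight in either list; their sum attains the bound just
    shown.\<close>
  obtain g where g: "g \<in> set gs" "Max ((\<lambda>g. g \<bullet> w) ` set gs) = g \<bullet> w"
    using assms(1) by (auto intro: obtains_MAX[of "set gs" "\<lambda>g. g \<bullet> w"])
  obtain h where h: "h \<in> set hs" "Max ((\<lambda>g. g \<bullet> w) ` set hs) = h \<bullet> w"
    using assms(2) by (auto intro: obtains_MAX[of "set hs" "\<lambda>g. g \<bullet> w"])
  have "g \<bullet> w + h \<bullet> w = (g + h) \<bullet> w" "g + h \<in> set (list_mult gs hs)"
    using g h add by (auto simp: set_list_mult)
  then show "Max ((\<lambda>g. g \<bullet> w) ` set gs) + Max ((\<lambda>g. g \<bullet> w) ` set hs) \<in> (\<lambda>g. g \<bullet> w) ` set (list_mult gs hs)"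
    unfolding g h by blast
qed simp

text \<open>
  A quotient of two Laurent polynomials with positive coefficients (as lists of exponent vectors
  with repetitions), together with the difference of their degrees in the grading by \<open>w\<close>.
\<close>

definition quotient_degree :: "int vec \<Rightarrow> 'a \<Rightarrow> int \<Rightarrow> bool" where
  "quotient_degree w a v \<longleftrightarrow>
     (\<exists>gs hs. gs \<noteq> [] \<and> hs \<noteq> [] \<and> set gs \<subseteq> carrier_vec m \<and> set hs \<subseteq> carrier_vec m \<and>
        a = monom_sum gs / monom_sum hs \<and> v = trop_degree w gs - trop_degree w hs)"

lemma list_mult_closed:
  assumes "gs \<noteq> []" "hs \<noteq> []" "set gs \<subseteq> carrier_vec m" "set hs \<subseteq> carrier_vec m"
  shows "list_mult gs hs \<noteq> []" "set (list_mult gs hs) \<subseteq> carrier_vec m"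
proof -
  have "set (list_mult gs hs) \<noteq> {}"
    using assms by (auto simp: set_list_mult)
  then show "list_mult gs hs \<noteq> []" by auto
  show "set (list_mult gs hs) \<subseteq> carrier_vec m"
    using assms by (fastforce simp: set_list_mult intro!: add_carrier_vec)
qed

lemma quotient_degree_nonzero: "quotient_degree w a v \<Longrightarrow> a \<noteq> 0"
  unfolding quotient_degree_def using monom_sum_nonzero by fastforce

text \<open>Cross-multiplication turns two representations of \<open>a\<close> into one equality of
  positive Laurent polynomials. These have equal supports, hence equal degrees, and degrees are
  additive.\<close>

lemma quotient_degree_unique:
  assumes w: "w \<in> carrier_vec m" and "quotient_degree w a v" and "quotient_degree w a v'"
  shows "v = v'"
proof -
  obtain gs hs where 1: "gs \<noteq> []" "hs \<noteq> []" "set gs \<subseteq> carrier_vec m" "set hs \<subseteq> carrier_vec m"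
    "a = monom_sum gs / monom_sum hs" "v = trop_degree w gs - trop_degree w hs"
    using assms(2) unfolding quotient_degree_def by blast
  obtain gs' hs' where 2: "gs' \<noteq> []" "hs' \<noteq> []" "set gs' \<subseteq> carrier_vec m" "set hs' \<subseteq> carrier_vec m"
    "a = monom_sum gs' / monom_sum hs'" "v' = trop_degree w gs' - trop_degree w hs'"
    using assms(3) unfolding quotient_degree_def by blast
  have "monom_sum hs \<noteq> 0" "monom_sum hs' \<noteq> 0"
    using 1 2 by (simp_all add: monom_sum_nonzero)
  with 1(5) 2(5) have "monom_sum gs * monom_sum hs' = monom_sum gs' * monom_sum hs"
    by (simp add: frac_eq_eq)
  then have "monom_sum (list_mult gs hs') = monom_sum (list_mult gs' hs)"
    using 1 2 by (simp add: monom_sum_list_mult)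
  then have "set (list_mult gs hs') = set (list_mult gs' hs)"
    using 1 2 by (intro monom_sum_eq_imp_set_eq list_mult_closed)
  then have "trop_degree w (list_mult gs hs') = trop_degree w (list_mult gs' hs)"
    by (simp add: trop_degree_def)
  then show ?thesis
    using 1 2 w by (simp add: trop_degree_list_mult)
qed

lemma quotient_degree_mult:
  assumes w: "w \<in> carrier_vec m" and "quotient_degree w a v" and "quotient_degree w b v'"
  shows "quotient_degree w (a * b) (v + v')"
proof -
  obtain gs hs where 1: "gs \<noteq> []" "hs \<noteq> []" "set gs \<subseteq> carrier_vec m" "set hs \<subseteq> carrier_vec m"
    "a = monom_sum gs / monom_sum hs" "v = trop_degree w gs - trop_degree w hs"
    using assms(2) unfolding quotient_degree_def by blast
  obtain gs' hs' where 2: "gs' \<noteq> []" "hs' \<noteq> []" "set gs' \<subseteq> carrier_vec m" "set hs' \<subseteq> carrier_vec m"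
    "b = monom_sum gs' / monom_sum hs'" "v' = trop_degree w gs' - trop_degree w hs'"
    using assms(3) unfolding quotient_degree_def by blast
  show ?thesis
    unfolding quotient_degree_def
    by (rule exI[of _ "list_mult gs gs'"], rule exI[of _ "list_mult hs hs'"])
       (use 1 2 w in \<open>simp add: list_mult_closed monom_sum_list_mult trop_degree_list_mult\<close>)
qed

lemma quotient_degree_inverse:
  "quotient_degree w a v \<Longrightarrow> quotient_degree w (inverse a) (- v)"
  unfolding quotient_degree_def by (metis inverse_divide minus_diff_eq)

text \<open>Over the common denominator the numerators are concatenated, and the degree of a
  concatenation is the maximum of the degrees.\<close>

lemma quotient_degree_add:
  assumes w: "w \<in> carrier_vec m" and "quotient_degree w a v" and "quotient_degree w b v'"
  shows "quotient_degree w (a + b) (max v v')"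
proof -
  obtain gs hs where 1: "gs \<noteq> []" "hs \<noteq> []" "set gs \<subseteq> carrier_vec m" "set hs \<subseteq> carrier_vec m"
    "a = monom_sum gs / monom_sum hs" "v = trop_degree w gs - trop_degree w hs"
    using assms(2) unfolding quotient_degree_def by blast
  obtain gs' hs' where 2: "gs' \<noteq> []" "hs' \<noteq> []" "set gs' \<subseteq> carrier_vec m" "set hs' \<subseteq> carrier_vec m"
    "b = monom_sum gs' / monom_sum hs'" "v' = trop_degree w gs' - trop_degree w hs'"
    using assms(3) unfolding quotient_degree_def by blast
  have "monom_sum hs \<noteq> 0" "monom_sum hs' \<noteq> 0"
    using 1 2 by (simp_all add: monom_sum_nonzero)
  then have "a + b = monom_sum (list_mult gs hs' @ list_mult gs' hs) / monom_sum (list_mult hs hs')"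
    using 1 2 by (simp add: monom_sum_list_mult add_frac_eq)
  moreover have "max v v' = trop_degree w (list_mult gs hs' @ list_mult gs' hs) - trop_degree w (list_mult hs hs')"
    using 1 2 w by (simp add: trop_degree_append list_mult_closed trop_degree_list_mult max_def)
  moreover have "list_mult gs hs' @ list_mult gs' hs \<noteq> []" "list_mult hs hs' \<noteq> []"
    "set (list_mult gs hs' @ list_mult gs' hs) \<subseteq> carrier_vec m" "set (list_mult hs hs') \<subseteq> carrier_vec m"
    using 1 2 by (simp_all add: list_mult_closed)
  ultimately show ?thesis
    unfolding quotient_degree_def by blast
qed

section \<open>Universal property of the semifield of subtraction-free expressions\<close>

lemma quotient_degree_generator:
  assumes "w \<in> carrier_vec m" and "i < m"
  shows "quotient_degree w (x $ i) (w $ i)"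
  unfolding quotient_degree_def
  by (rule exI[of _ "[unit_vec m i]"], rule exI[of _ "[0\<^sub>v m]"])
     (use assms in \<open>simp add: trop_degree_def laurent_monom_unit laurent_monom_zero\<close>)

lemma subtraction_free_quotient_degree:
  assumes w: "w \<in> carrier_vec m" and "a \<in> subtraction_free (set\<^sub>v x)"
  shows "\<exists>v. quotient_degree w a v"
  using assms(2)
proof induction
  case (base a)
  then show ?case
    using quotient_degree_generator[OF w] by (auto simp: vec_set_def)
next
  case (divide a b)
  then show ?case
    using quotient_degree_mult[OF w] quotient_degree_inverse unfolding divide_inverse by blast
qed (use quotient_degree_add[OF w] quotient_degree_mult[OF w] in blast)+

text \<open>Any weight serves here; the zero vector is chosen.\<close>

lemma subtraction_free_nonzero: "a \<in> subtraction_free (set\<^sub>v x) \<Longrightarrow> a \<noteq> 0"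
  using subtraction_free_quotient_degree[of "0\<^sub>v m" a] quotient_degree_nonzero by auto

text \<open>The quotient degree depends only on the element, not on the expression chosen for it,
  and therefore defines a homomorphism with prescribed values on the cluster.\<close>

lemma max_plus_hom_exists:
  assumes w: "w \<in> carrier_vec m"
  shows "\<exists>\<beta>. max_plus_hom (subtraction_free (set\<^sub>v x)) \<beta> \<and> (\<forall>i<m. \<beta> (x $ i) = w $ i)"
proof -
  let ?P = "subtraction_free (set\<^sub>v x)"
  define \<beta> where "\<beta> = restrict (\<lambda>a. THE v. quotient_degree w a v) ?P"
  have \<beta>: "\<beta> a = v" if "a \<in> ?P" "quotient_degree w a v" for a v
    unfolding \<beta>_def using that quotient_degree_unique[OF w] by (auto intro!: the_equality)
  have deg: "quotient_degree w a (\<beta> a)" if "a \<in> ?P" for a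
    using subtraction_free_quotient_degree[OF w that] \<beta>[OF that] by auto
  have "max_plus_hom ?P \<beta>"
    unfolding max_plus_hom_def
  proof (intro conjI ballI)
    show "\<beta> \<in> extensional ?P"
      by (simp add: \<beta>_def)
  next
    fix a b assume "a \<in> ?P" "b \<in> ?P"
    then show "\<beta> (a * b) = \<beta> a + \<beta> b" "\<beta> (a + b) = max (\<beta> a) (\<beta> b)"
      by (simp_all add: \<beta> deg subtraction_free.intros quotient_degree_mult quotient_degree_add w)
  qed
  moreover have "\<beta> (x $ i) = w $ i" if "i < m" for i
    using that w by (intro \<beta> subtraction_free.base quotient_degree_generator) (auto simp: vec_setI)
  ultimately show ?thesis by blast
qed

lemma max_plus_hom_divide:
  assumes \<beta>: "max_plus_hom (subtraction_free (set\<^sub>v x)) \<beta>"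
    and "a \<in> subtraction_free (set\<^sub>v x)" and "b \<in> subtraction_free (set\<^sub>v x)"
  shows "\<beta> (a / b) = \<beta> a - \<beta> b"
proof -
  have "\<beta> (a / b * b) = \<beta> (a / b) + \<beta> b"
    using \<beta> assms(2,3) subtraction_free.divide[OF assms(2,3)] unfolding max_plus_hom_def by blast
  then show ?thesis
    using subtraction_free_nonzero[OF assms(3)] by simp
qed

lemma max_plus_hom_unique:
  assumes \<beta>: "max_plus_hom (subtraction_free (set\<^sub>v x)) \<beta>"
    and \<beta>': "max_plus_hom (subtraction_free (set\<^sub>v x)) \<beta>'"
    and eq: "\<And>i. i < m \<Longrightarrow> \<beta> (x $ i) = \<beta>' (x $ i)"
  shows "\<beta> = \<beta>'"
proof (rule extensionalityI[of _ "subtraction_free (set\<^sub>v x)"])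
  fix a assume "a \<in> subtraction_free (set\<^sub>v x)"
  then show "\<beta> a = \<beta>' a"
  proof induction
    case (base a)
    then show ?case using eq by (auto simp: vec_set_def)
  next
    case (divide a b)
    then show ?case using max_plus_hom_divide[OF \<beta>] max_plus_hom_divide[OF \<beta>'] by simp
  qed (use \<beta> \<beta>' in \<open>simp_all add: max_plus_hom_def\<close>)
qed (use \<beta> \<beta>' in \<open>simp_all add: max_plus_hom_def\<close>)

lemma max_plus_hom_prod:
  assumes \<beta>: "max_plus_hom (subtraction_free (set\<^sub>v x)) \<beta>" and "0 < m"
    and f: "\<And>i. i < (r::nat) \<Longrightarrow> f i \<in> subtraction_free (set\<^sub>v x)"
  shows "(\<Prod>i<r. f i powi e i) \<in> subtraction_free (set\<^sub>v x) \<and>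
    \<beta> (\<Prod>i<r. f i powi e i) = (\<Sum>i<r. e i * \<beta> (f i))"
proof -
  let ?P = "subtraction_free (set\<^sub>v x)"
  have mult: "\<beta> (a * b) = \<beta> a + \<beta> b" if "a \<in> ?P" "b \<in> ?P" for a b
    using \<beta> that unfolding max_plus_hom_def by blast
  \<comment> \<open>Some generator is needed to obtain 1 as x_0 / x_0; this is where 0 < m
    enters.\<close>
  have gen: "x $ 0 \<in> ?P"
    using \<open>0 < m\<close> by (intro subtraction_free.base) (auto simp: vec_setI)
  have one: "1 \<in> ?P" "\<beta> 1 = 0"
    using subtraction_free.divide[OF gen gen] max_plus_hom_divide[OF \<beta> gen gen] nonzero[OF \<open>0 < m\<close>] by simp_all
  have pow: "a ^ j \<in> ?P \<and> \<beta> (a ^ j) = int j * \<beta> a" if "a \<in> ?P" for a j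
    using that by (induction j) (simp_all add: one mult subtraction_free.mult algebra_simps)
  have powi: "a powi j \<in> ?P \<and> \<beta> (a powi j) = j * \<beta> a" if "a \<in> ?P" for a j
  proof (cases "j \<ge> 0")
    case True
    then show ?thesis using pow[OF that, of "nat j"] by (simp add: power_int_def)
  next
    case False
    have "a powi j = 1 / a ^ nat (- j)"
      using False by (simp add: power_int_def field_simps)
    then show ?thesis
      using False pow[OF that, of "nat (- j)"] one max_plus_hom_divide[OF \<beta>, of 1]
      by (simp add: subtraction_free.divide)
  qed
  show ?thesis
    using f by (induction r) (simp_all add: one powi mult subtraction_free.mult)
qed

end


section \<open>Compatible pairs and tropical mutation\<close>

lemma pos_part_minus: "[- a]\<^sub>+ = [a]\<^sub>+ - a"
  by (simp add: pos_part_def max_def)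

text \<open>The condition is kept abstract so that the sign of s_k g_k can be replaced by the sign
  of g_k.\<close>

lemma max_add_if:
  fixes a p :: int
  assumes "0 \<le> p \<longleftrightarrow> Q"
  shows "max (a + p) a = (if Q then a + p else a)"
  using assms by auto

lemma mult_mat_vec_index_sum:
  "A \<in> carrier_mat r c \<Longrightarrow> v \<in> carrier_vec c \<Longrightarrow> i < r \<Longrightarrow> (A *\<^sub>v v) $ i = (\<Sum>j<c. A $$ (i,j) * v $ j)"
  by (auto simp: scalar_prod_def atLeast0LessThan intro!: sum.cong)

lemma scalar_prod_sum: "w \<in> carrier_vec r \<Longrightarrow> v \<bullet> w = (\<Sum>i<r. v $ i * w $ i)"
  by (simp add: scalar_prod_def atLeast0LessThan)

locale compatible =
  fixes m n :: nat and s :: "nat \<Rightarrow> int" and B \<Lambda> :: "int mat"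
  assumes le: "n \<le> m" and compatible_pair: "compatible_pair m n s B \<Lambda>"
begin

lemma B_carrier: "B \<in> carrier_mat m n" and \<Lambda>_carrier: "\<Lambda> \<in> carrier_mat m m"
  and s_pos: "k < n \<Longrightarrow> s k > 0"
  using compatible_pair by (auto simp: compatible_pair_def)

lemma \<Lambda>_skew:
  assumes "i < m" and "j < m"
  shows "\<Lambda> $$ (i,j) = - \<Lambda> $$ (j,i)"
proof -
  have "transpose_mat \<Lambda> $$ (j,i) = (- \<Lambda>) $$ (j,i)"
    using compatible_pair by (simp add: compatible_pair_def skew_symmetric_def)
  then show ?thesis
    using assms \<Lambda>_carrier by simp
qed

lemma B_\<Lambda>_sum:
  assumes "k < n" and "j < m"
  shows "(\<Sum>i<m. B $$ (i,k) * \<Lambda> $$ (i,j)) = (if k = j then s k else 0)"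
proof -
  have "(transpose_mat B * \<Lambda>) $$ (k,j) = (if k = j then s k else 0)"
    using compatible_pair assms by (simp add: compatible_pair_def)
  then show ?thesis
    using assms B_carrier \<Lambda>_carrier by (simp add: scalar_prod_def atLeast0LessThan)
qed

lemma \<Lambda>_B_sum:
  assumes "k < n" and "i < m"
  shows "(\<Sum>j<m. \<Lambda> $$ (i,j) * B $$ (j,k)) = (if i = k then - s k else 0)"
proof -
  have "(\<Sum>j<m. \<Lambda> $$ (i,j) * B $$ (j,k)) = (\<Sum>j<m. - (B $$ (j,k) * \<Lambda> $$ (j,i)))"
  proof (rule sum.cong)
    fix j assume "j \<in> {..<m}"
    then have "\<Lambda> $$ (i,j) = - \<Lambda> $$ (j,i)"
      using assms \<Lambda>_skew by blast
    then show "\<Lambda> $$ (i,j) * B $$ (j,k) = - (B $$ (j,k) * \<Lambda> $$ (j,i))"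
      by (simp only: mult_ac mult_minus_left mult_minus_right)
  qed simp
  then show ?thesis
    using B_\<Lambda>_sum[OF assms] by (simp add: sum_negf)
qed

text \<open>Compatibility in the form used throughout: pairing column k of B with \<Lambda> v reads
  off the k-th entry of v up to the positive factor s_k.\<close>

lemma B_pairing:
  assumes "k < n" and "v \<in> carrier_vec m"
  shows "(\<Sum>i<m. B $$ (i,k) * (\<Lambda> *\<^sub>v v) $ i) = s k * v $ k"
proof -
  have "(\<Sum>i<m. B $$ (i,k) * (\<Lambda> *\<^sub>v v) $ i) = (\<Sum>i<m. \<Sum>j<m. B $$ (i,k) * \<Lambda> $$ (i,j) * v $ j)"
    using assms \<Lambda>_carrier
    by (simp add: mult_mat_vec_index_sum sum_distrib_left mult.assoc del: index_mult_mat_vec)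
  also have "\<dots> = (\<Sum>j<m. (\<Sum>i<m. B $$ (i,k) * \<Lambda> $$ (i,j)) * v $ j)"
    by (subst sum.swap) (simp add: sum_distrib_right)
  also have "\<dots> = (\<Sum>j<m. if k = j then s k * v $ j else 0)"
    by (rule sum.cong) (use assms B_\<Lambda>_sum in auto)
  also have "\<dots> = s k * v $ k"
    using assms le by simp
  finally show ?thesis .
qed

text \<open>Column k of B is paired with \<Lambda> times itself. \<open>B_pairing\<close> gives s_k
  b_kk, whereas \<open>\<Lambda>_B_sum\<close> gives - s_k b_kk.\<close>

lemma B_diag: "B $$ (k,k) = 0" if "k < n"
proof -
  have "s k * B $$ (k,k) = (\<Sum>i<m. B $$ (i,k) * (\<Lambda> *\<^sub>v col B k) $ i)"
    using B_pairing[of k "col B k"] B_carrier that le by simp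
  also have "\<dots> = (\<Sum>i<m. if i = k then - s k * B $$ (k,k) else 0)"
  proof (rule sum.cong)
    fix i assume "i \<in> {..<m}"
    then have "(\<Lambda> *\<^sub>v col B k) $ i = (\<Sum>j<m. \<Lambda> $$ (i,j) * B $$ (j,k))"
      using that B_carrier \<Lambda>_carrier by (simp add: mult_mat_vec_index_sum del: index_mult_mat_vec)
    then show "B $$ (i,k) * (\<Lambda> *\<^sub>v col B k) $ i = (if i = k then - s k * B $$ (k,k) else 0)"
      using \<Lambda>_B_sum[OF that, of i] \<open>i \<in> {..<m}\<close> by simp
  qed simp
  also have "\<dots> = - s k * B $$ (k,k)"
    using that le by simp
  finally show ?thesis
    using s_pos[OF that] by simp
qed

text \<open>Pairing B v with column j of \<Lambda> returns s_j v_j, so v can be recovered from B v.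
  This is the statement that B has rank n.\<close>

lemma B_kernel:
  assumes "v \<in> carrier_vec n" and "B *\<^sub>v v = 0\<^sub>v m"
  shows "v = 0\<^sub>v n"
proof (rule eq_vecI)
  fix j assume "j < dim_vec (0\<^sub>v n)"
  then have j: "j < n" "j < m" using le by auto
  have "0 = (\<Sum>i<m. (B *\<^sub>v v) $ i * \<Lambda> $$ (i,j))"
    unfolding assms(2) by simp
  also have "\<dots> = (\<Sum>i<m. \<Sum>k<n. B $$ (i,k) * v $ k * \<Lambda> $$ (i,j))"
    using assms(1) B_carrier
    by (simp add: mult_mat_vec_index_sum sum_distrib_right del: index_mult_mat_vec)
  also have "\<dots> = (\<Sum>k<n. v $ k * (\<Sum>i<m. B $$ (i,k) * \<Lambda> $$ (i,j)))"
    by (subst sum.swap) (simp only: sum_distrib_left mult_ac)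
  also have "\<dots> = (\<Sum>k<n. if k = j then v $ j * s j else 0)"
    by (rule sum.cong) (use B_\<Lambda>_sum j in auto)
  also have "\<dots> = v $ j * s j"
    using j by simp
  finally show "v $ j = 0\<^sub>v n $ j"
    using j s_pos[of j] by simp
qed (use assms in simp)

lemma \<Lambda>_pairing_skew:
  assumes "g \<in> carrier_vec m" and "h \<in> carrier_vec m"
  shows "g \<bullet> (\<Lambda> *\<^sub>v h) = - (h \<bullet> (\<Lambda> *\<^sub>v g))"
proof -
  have expand: "v \<bullet> (\<Lambda> *\<^sub>v w) = (\<Sum>i<m. \<Sum>j<m. v $ i * \<Lambda> $$ (i,j) * w $ j)"
    if "w \<in> carrier_vec m" for v w
    using that \<Lambda>_carrier
    by (simp add: scalar_prod_sum[of _ m] mult_mat_vec_index_sum sum_distrib_left mult.assoc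
        del: index_mult_mat_vec)
  have "g \<bullet> (\<Lambda> *\<^sub>v h) = (\<Sum>j<m. \<Sum>i<m. g $ i * \<Lambda> $$ (i,j) * h $ j)"
    unfolding expand[OF assms(2)] by (rule sum.swap)
  also have "\<dots> = (\<Sum>j<m. \<Sum>i<m. - (h $ j * \<Lambda> $$ (j,i) * g $ i))"
  proof (intro sum.cong refl)
    fix i j assume "j \<in> {..<m}" "i \<in> {..<m}"
    then have "\<Lambda> $$ (i,j) = - \<Lambda> $$ (j,i)"
      using \<Lambda>_skew by blast
    then show "g $ i * \<Lambda> $$ (i,j) * h $ j = - (h $ j * \<Lambda> $$ (j,i) * g $ i)"
      by (simp only: mult_ac mult_minus_left mult_minus_right)
  qed
  finally show ?thesis
    unfolding expand[OF assms(1)] by (simp add: sum_negf)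
qed

end

section \<open>Mutation along a single edge\<close>

locale tropical_mutation = compatible +
  fixes k :: nat and \<epsilon> :: int and \<Lambda>' :: "int mat"
  assumes k: "k < n" and \<epsilon>: "\<epsilon> \<in> {1, - 1}"
    and \<Lambda>': "\<Lambda>' = transpose_mat (mutation_E \<epsilon> k B) * \<Lambda> * mutation_E \<epsilon> k B"
begin

definition mutated_g :: "int vec \<Rightarrow> int vec \<Rightarrow> bool" where
  "mutated_g g g' \<longleftrightarrow> g \<in> carrier_vec m \<and> g' \<in> carrier_vec m \<and> g' $ k = - g $ k \<and>
     (\<forall>i<m. i \<noteq> k \<longrightarrow> g' $ i = g $ i + [- B $$ (i,k)]\<^sub>+ * g $ k + B $$ (i,k) * [g $ k]\<^sub>+)"

lemma E_carrier: "mutation_E \<epsilon> k B \<in> carrier_mat m m"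
  using B_carrier by (simp add: mutation_E_def)

text \<open>E undoes the mutation of g up to a multiple of column k of B. For i = k the correction
  disappears because b_kk = 0.\<close>

lemma E_mult_vec:
  assumes "mutated_g g g'" and "i < m"
  shows "(mutation_E \<epsilon> k B *\<^sub>v g') $ i = g $ i + [\<epsilon> * g $ k]\<^sub>+ * B $$ (i,k)"
proof -
  have g': "g' \<in> carrier_vec m" "k < m"
    using assms k le by (auto simp: mutated_g_def)
  have "(mutation_E \<epsilon> k B *\<^sub>v g') $ i = (\<Sum>j<m. mutation_E \<epsilon> k B $$ (i,j) * g' $ j)"
    by (rule mult_mat_vec_index_sum) (use E_carrier g' assms in auto)
  also have "\<dots> = (\<Sum>j<m. (if j = k then (if i = k then - g' $ k else [- \<epsilon> * B $$ (i,k)]\<^sub>+ * g' $ k) else 0) +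
      (if j = i then (if i = k then 0 else g' $ i) else 0))"
    by (rule sum.cong) (use B_carrier assms in \<open>auto simp: mutation_E_def\<close>)
  also have "\<dots> = (if i = k then - g' $ k else [- \<epsilon> * B $$ (i,k)]\<^sub>+ * g' $ k) + (if i = k then 0 else g' $ i)"
    using g' assms by (simp add: sum.distrib)
  also have "\<dots> = g $ i + [\<epsilon> * g $ k]\<^sub>+ * B $$ (i,k)"
  proof (cases "i = k")
    case True
    then show ?thesis
      using assms B_diag[OF k] by (simp add: mutated_g_def)
  next
    case False
    then have "g' $ i = g $ i + [- B $$ (i,k)]\<^sub>+ * g $ k + B $$ (i,k) * [g $ k]\<^sub>+" "g' $ k = - g $ k"
      using assms by (auto simp: mutated_g_def)
    then show ?thesis
      using False \<epsilon> by (auto simp: pos_part_minus algebra_simps)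
  qed
  finally show ?thesis .
qed

text \<open>The two sums are the tropical values of the two monomials in the exchange relation. They
  differ by s_k g_k, so the sign of g_k decides which one is the maximum.\<close>

lemma pos_neg_sums:
  assumes "g \<in> carrier_vec m"
  shows "(\<Sum>j<m. [B $$ (j,k)]\<^sub>+ * (\<Lambda> *\<^sub>v g) $ j) = (\<Sum>j<m. [- B $$ (j,k)]\<^sub>+ * (\<Lambda> *\<^sub>v g) $ j) + s k * g $ k"
proof -
  have "(\<Sum>j<m. [B $$ (j,k)]\<^sub>+ * (\<Lambda> *\<^sub>v g) $ j) =
      (\<Sum>j<m. [- B $$ (j,k)]\<^sub>+ * (\<Lambda> *\<^sub>v g) $ j + B $$ (j,k) * (\<Lambda> *\<^sub>v g) $ j)"
    by (rule sum.cong) (simp_all add: pos_part_minus algebra_simps del: index_mult_mat_vec)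
  then show ?thesis
    using B_pairing[OF k assms] by (simp add: sum.distrib del: index_mult_mat_vec)
qed

text \<open>
  The vectors \<open>\<Lambda> g\<close> transform under mutation like the tropicalization of the exchange relation.
\<close>

lemma \<Lambda>_mutated_g:
  assumes gg': "mutated_g g g'" and "i < m"
  shows "(\<Lambda>' *\<^sub>v g') $ i =
    (if i = k then max (\<Sum>j<m. [B $$ (j,k)]\<^sub>+ * (\<Lambda> *\<^sub>v g) $ j) (\<Sum>j<m. [- B $$ (j,k)]\<^sub>+ * (\<Lambda> *\<^sub>v g) $ j)
        - (\<Lambda> *\<^sub>v g) $ k
     else (\<Lambda> *\<^sub>v g) $ i)"
proof -
  let ?E = "mutation_E \<epsilon> k B" and ?r = "\<Lambda> *\<^sub>v g" and ?d = "[\<epsilon> * g $ k]\<^sub>+"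
  have g: "g \<in> carrier_vec m" "g' \<in> carrier_vec m" "k < m"
    using gg' k le by (auto simp: mutated_g_def)
  have E: "?E \<in> carrier_mat m m" "transpose_mat ?E \<in> carrier_mat m m"
    using E_carrier by auto
  have Eg: "?E *\<^sub>v g' \<in> carrier_vec m"
    using E g by auto
  \<comment> \<open>\<Lambda> maps column k of B to - s_k times the k-th unit vector, so the
    correction from \<open>E_mult_vec\<close> survives only in entry k.\<close>
  have \<Lambda>Eg: "(\<Lambda> *\<^sub>v (?E *\<^sub>v g')) $ j = ?r $ j - (if j = k then ?d * s k else 0)" if "j < m" for j
  proof -
    have "(\<Lambda> *\<^sub>v (?E *\<^sub>v g')) $ j = (\<Sum>l<m. \<Lambda> $$ (j,l) * (g $ l + ?d * B $$ (l,k)))"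
      using E_mult_vec[OF gg'] mult_mat_vec_index_sum[OF \<Lambda>_carrier Eg that] by simp
    also have "\<dots> = ?r $ j + ?d * (\<Sum>l<m. \<Lambda> $$ (j,l) * B $$ (l,k))"
      using that by (simp add: mult_mat_vec_index_sum[OF \<Lambda>_carrier g(1)] distrib_left sum.distrib sum_distrib_left
          mult_ac del: index_mult_mat_vec)
    finally show ?thesis
      using \<Lambda>_B_sum[OF k that] by simp
  qed
  have "\<Lambda>' *\<^sub>v g' = transpose_mat ?E *\<^sub>v (\<Lambda> *\<^sub>v (?E *\<^sub>v g'))"
    unfolding \<Lambda>' using E \<Lambda>_carrier g Eg by (simp add: assoc_mult_mat_vec[of _ m m _ m])
  then have "(\<Lambda>' *\<^sub>v g') $ i = (\<Sum>j<m. transpose_mat ?E $$ (i,j) * (\<Lambda> *\<^sub>v (?E *\<^sub>v g')) $ j)"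
    using mult_mat_vec_index_sum[OF E(2) _ \<open>i < m\<close>] \<Lambda>_carrier Eg by simp
  also have "\<dots> = (\<Sum>j<m. ?E $$ (j,i) * (?r $ j - (if j = k then ?d * s k else 0)))"
    by (rule sum.cong) (use E \<open>i < m\<close> \<Lambda>Eg in auto)
  finally have eq: "(\<Lambda>' *\<^sub>v g') $ i = \<dots>" .
  show ?thesis
  proof (cases "i = k")
    case False
    have "(\<Sum>j<m. ?E $$ (j,i) * (?r $ j - (if j = k then ?d * s k else 0))) =
        (\<Sum>j<m. if j = i then ?r $ i else 0)"
      by (rule sum.cong) (use False B_carrier \<open>i < m\<close> in \<open>auto simp: mutation_E_def\<close>)
    then show ?thesis
      using eq False \<open>i < m\<close> by simp
  next
    case True
    have "(\<Sum>j<m. ?E $$ (j,k) * (?r $ j - (if j = k then ?d * s k else 0))) =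
        (\<Sum>j<m. [- \<epsilon> * B $$ (j,k)]\<^sub>+ * ?r $ j + (if j = k then ?d * s k - ?r $ k else 0))"
      by (rule sum.cong)
         (use B_carrier g B_diag[OF k] in \<open>auto simp: mutation_E_def pos_part_def simp del: index_mult_mat_vec\<close>)
    then have "(\<Lambda>' *\<^sub>v g') $ k = (\<Sum>j<m. [- \<epsilon> * B $$ (j,k)]\<^sub>+ * ?r $ j) + ?d * s k - ?r $ k"
      using eq True g by (simp add: sum.distrib del: index_mult_mat_vec)
    moreover define P where "P = (\<Sum>j<m. [B $$ (j,k)]\<^sub>+ * ?r $ j)"
    moreover define N where "N = (\<Sum>j<m. [- B $$ (j,k)]\<^sub>+ * ?r $ j)"
    ultimately have "(\<Lambda>' *\<^sub>v g') $ k = (if \<epsilon> = 1 then N + [g $ k]\<^sub>+ * s k else P + [- g $ k]\<^sub>+ * s k) - ?r $ k"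
      using \<epsilon> by auto
    moreover have PN: "P = N + s k * g $ k"
      unfolding P_def N_def by (rule pos_neg_sums[OF g(1)])
    moreover have "s k * g $ k \<ge> 0 \<longleftrightarrow> g $ k \<ge> 0"
      using s_pos[OF k] by (simp add: zero_le_mult_iff)
    then have "max P N = (if g $ k \<ge> 0 then P else N)"
      unfolding PN by (rule max_add_if)
    \<comment> \<open>Both signs lead to the same value: N + s_k [g_k]_+ and P + s_k [- g_k]_+ are
      both the maximum of P and N.\<close>
    ultimately have "(\<Lambda>' *\<^sub>v g') $ k = max P N - ?r $ k"
      using \<epsilon> by (simp add: pos_part_def algebra_simps del: index_mult_mat_vec)
    then show ?thesis
      using True by (simp add: P_def N_def del: index_mult_mat_vec)
  qed
qed

text \<open>The change is 0 when g_k and h_k have no opposite signs, and s_k |g_k| h_k otherwise. It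
  arises from comparing the maximum in the k-th entry of the mutated vector with the sums over
  column k of B.\<close>

lemma \<Lambda>_pairing_mutated:
  assumes gg': "mutated_g g g'" and hh': "mutated_g h h'"
  shows "g' \<bullet> (\<Lambda>' *\<^sub>v h') - g \<bullet> (\<Lambda> *\<^sub>v h) = s k * (if h $ k \<ge> 0 then [- g $ k]\<^sub>+ else [g $ k]\<^sub>+) * h $ k"
proof -
  let ?r = "\<Lambda> *\<^sub>v h"
  let ?P = "\<Sum>j<m. [B $$ (j,k)]\<^sub>+ * ?r $ j" and ?N = "\<Sum>j<m. [- B $$ (j,k)]\<^sub>+ * ?r $ j"
  have h: "h \<in> carrier_vec m" "k < m" and g: "g \<in> carrier_vec m"
    using gg' hh' k le by (auto simp: mutated_g_def)
  have "\<Lambda>' \<in> carrier_mat m m"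
    unfolding \<Lambda>' using E_carrier \<Lambda>_carrier by (meson mult_carrier_mat transpose_carrier_mat)
  then have carr: "\<Lambda>' *\<^sub>v h' \<in> carrier_vec m" "?r \<in> carrier_vec m"
    using hh' \<Lambda>_carrier by (auto simp: mutated_g_def)
  have "g' \<bullet> (\<Lambda>' *\<^sub>v h') = (\<Sum>i<m. g' $ i * (\<Lambda>' *\<^sub>v h') $ i)"
    by (rule scalar_prod_sum[OF carr(1)])
  \<comment> \<open>The entry i = k fits the same formula as the others because b_kk = 0; only the
    term with the maximum is special to it.\<close>
  also have "\<dots> = (\<Sum>i<m. g $ i * ?r $ i + g $ k * ([- B $$ (i,k)]\<^sub>+ * ?r $ i) + [g $ k]\<^sub>+ * (B $$ (i,k) * ?r $ i)
      - (if i = k then g $ k * max ?P ?N else 0))"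
  proof (rule sum.cong)
    fix i assume "i \<in> {..<m}"
    then have i: "i < m" by simp
    show "g' $ i * (\<Lambda>' *\<^sub>v h') $ i = g $ i * ?r $ i + g $ k * ([- B $$ (i,k)]\<^sub>+ * ?r $ i) +
        [g $ k]\<^sub>+ * (B $$ (i,k) * ?r $ i) - (if i = k then g $ k * max ?P ?N else 0)"
    proof (cases "i = k")
      case True
      have "g' $ k = - g $ k"
        using gg' by (simp add: mutated_g_def)
      then show ?thesis
        unfolding \<Lambda>_mutated_g[OF hh' i] using True B_diag[OF k]
        by (simp add: pos_part_def algebra_simps del: index_mult_mat_vec)
    next
      case False
      then have "g' $ i = g $ i + [- B $$ (i,k)]\<^sub>+ * g $ k + B $$ (i,k) * [g $ k]\<^sub>+"
        using gg' i by (simp add: mutated_g_def)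
      then show ?thesis
        unfolding \<Lambda>_mutated_g[OF hh' i] using False by (simp add: algebra_simps del: index_mult_mat_vec)
    qed
  qed simp
  also have "\<dots> = g \<bullet> ?r + g $ k * ?N + [g $ k]\<^sub>+ * (s k * h $ k) - g $ k * max ?P ?N"
    using h by (simp add: sum.distrib sum_subtractf scalar_prod_sum[OF carr(2)] B_pairing[OF k h(1), symmetric]
        sum_distrib_left del: index_mult_mat_vec)
  finally have eq: "g' \<bullet> (\<Lambda>' *\<^sub>v h') - g \<bullet> ?r = g $ k * ?N + [g $ k]\<^sub>+ * (s k * h $ k) - g $ k * max ?P ?N"
    by simp
  have sign: "s k * h $ k \<ge> 0 \<longleftrightarrow> h $ k \<ge> 0"
    using s_pos[OF k] by (simp add: zero_le_mult_iff)
  have PN: "?P = ?N + s k * h $ k"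
    by (rule pos_neg_sums[OF h(1)])
  define N where "N = ?N"
  have "max ?P ?N = (if h $ k \<ge> 0 then N + s k * h $ k else N)"
    unfolding PN N_def by (rule max_add_if[OF sign])
  then show ?thesis
    unfolding eq N_def[symmetric] by (simp add: pos_part_minus algebra_simps)
qed

lemma sign_coherent_if_pairing_invariant:
  assumes "mutated_g g g'" and "mutated_g h h'" and "g' \<bullet> (\<Lambda>' *\<^sub>v h') = g \<bullet> (\<Lambda> *\<^sub>v h)"
  shows "g $ k * h $ k \<ge> 0"
proof -
  have "s k * (if h $ k \<ge> 0 then [- g $ k]\<^sub>+ else [g $ k]\<^sub>+) * h $ k = 0"
    using \<Lambda>_pairing_mutated[OF assms(1,2)] assms(3) by simp
  then have "h $ k = 0 \<or> (if h $ k \<ge> 0 then [- g $ k]\<^sub>+ else [g $ k]\<^sub>+) = 0"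
    using s_pos[OF k] by (auto split del: if_split)
  then show ?thesis
    by (cases "h $ k \<ge> 0") (auto simp: pos_part_def zero_le_mult_iff max_def split: if_splits)
qed

end


section \<open>Pointed elements\<close>

locale compatible_seed = independent_vec m x + compatible m n s B \<Lambda>
  for m n :: nat and x :: "'a::field_char_0 vec" and s B \<Lambda>
begin

text \<open>The exponent in x of the term with exponent \<alpha> in x^g F(y_hat).\<close>

definition shift_exponent :: "int vec \<Rightarrow> (nat \<Rightarrow>\<^sub>0 nat) \<Rightarrow> int vec" where
  "shift_exponent g \<alpha> = g + B *\<^sub>v vec n (\<lambda>k. int (Poly_Mapping.lookup \<alpha> k))"

lemma shift_exponent_carrier: "g \<in> carrier_vec m \<Longrightarrow> shift_exponent g \<alpha> \<in> carrier_vec m"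
  using B_carrier by (simp add: shift_exponent_def)

lemma shift_exponent_zero: "g \<in> carrier_vec m \<Longrightarrow> shift_exponent g 0 = g"
  using B_carrier by (auto simp: shift_exponent_def scalar_prod_def)

text \<open>B has trivial kernel, so distinct terms of an F-polynomial never merge in the Laurent
  expansion.\<close>

lemma inj_on_shift_exponent:
  assumes g: "g \<in> carrier_vec m"
  shows "inj_on (shift_exponent g) {\<alpha>. Poly_Mapping.keys \<alpha> \<subseteq> {..<n}}"
proof (rule inj_onI)
  fix \<alpha> \<beta> :: "nat \<Rightarrow>\<^sub>0 nat"
  assume keys: "\<alpha> \<in> {\<alpha>. Poly_Mapping.keys \<alpha> \<subseteq> {..<n}}" "\<beta> \<in> {\<alpha>. Poly_Mapping.keys \<alpha> \<subseteq> {..<n}}"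
    and eq: "shift_exponent g \<alpha> = shift_exponent g \<beta>"
  let ?v = "vec n (\<lambda>k. int (Poly_Mapping.lookup \<alpha> k))" and ?w = "vec n (\<lambda>k. int (Poly_Mapping.lookup \<beta> k))"
  have "B *\<^sub>v ?v = B *\<^sub>v ?w"
    using eq g B_carrier by (auto simp: shift_exponent_def vec_eq_iff)
  then have "B *\<^sub>v (?v - ?w) = 0\<^sub>v m"
    using B_carrier by (subst mult_minus_distrib_mat_vec[of _ m n]) auto
  then have "?v - ?w = 0\<^sub>v n"
    by (intro B_kernel) auto
  then have "Poly_Mapping.lookup \<alpha> i = Poly_Mapping.lookup \<beta> i" if "i < n" for i
    using that by (auto simp: vec_eq_iff)
  moreover have "Poly_Mapping.lookup \<alpha> i = 0" "Poly_Mapping.lookup \<beta> i = 0" if "\<not> i < n" for i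
    using keys that by (auto simp: in_keys_iff)
  ultimately show "\<alpha> = \<beta>"
    by (intro poly_mapping_eqI) metis
qed

text \<open>Terms of P correspond one to one to Laurent monomials; its constant term becomes the
  coefficient at g.\<close>

lemma pointed_with_expansion:
  assumes "pointed_with x B u g P"
  shows "\<exists>c. u = (\<Sum>h\<in>shift_exponent g ` Poly_Mapping.keys P. of_int (c h) * laurent_monom x h) \<and>
    g \<in> shift_exponent g ` Poly_Mapping.keys P \<and> c g = 1"
proof -
  let ?e = "shift_exponent g" and ?K = "Poly_Mapping.keys P"
  have P: "g \<in> carrier_vec m" "mpoly_in n P" "Poly_Mapping.lookup P 0 = 1"
    "u = laurent_monom x g * mpoly_eval of_int (y_hat x B) P"
    using assms B_carrier by (auto simp: pointed_with_def)
  have inj: "inj_on ?e ?K"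
    using inj_on_shift_exponent[OF P(1)] P(2) by (auto simp: mpoly_in_def intro: inj_on_subset)
  define c where "c h = Poly_Mapping.lookup P (the_inv_into ?K ?e h)" for h
  have c: "c (?e \<alpha>) = Poly_Mapping.lookup P \<alpha>" if "\<alpha> \<in> ?K" for \<alpha>
    using that inj by (simp add: c_def the_inv_into_f_f)
  have monom: "laurent_monom x (?e \<alpha>) = laurent_monom x g * power_product (y_hat x B) \<alpha>" if "\<alpha> \<in> ?K" for \<alpha>
    using that P(2) B_carrier
    by (simp add: shift_exponent_def laurent_monom_add power_product_y_hat mpoly_in_def)
  have "u = (\<Sum>\<alpha>\<in>?K. of_int (Poly_Mapping.lookup P \<alpha>) * (laurent_monom x g * power_product (y_hat x B) \<alpha>))"
    unfolding P(4) mpoly_eval_superset[of of_int, OF of_int_0 finite_keys order_refl] sum_distrib_left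
    by (simp only: mult_ac)
  also have "\<dots> = (\<Sum>\<alpha>\<in>?K. of_int (c (?e \<alpha>)) * laurent_monom x (?e \<alpha>))"
    by (rule sum.cong) (simp_all add: c monom)
  also have "\<dots> = (\<Sum>h\<in>?e ` ?K. of_int (c h) * laurent_monom x h)"
    by (simp add: sum.reindex[OF inj])
  finally have "u = \<dots>" .
  moreover have "0 \<in> ?K"
    using P(3) by (simp add: in_keys_iff)
  then have "g \<in> ?e ` ?K" "c g = 1"
    using c[of 0] P(3) shift_exponent_zero[OF P(1)] by (auto intro: image_eqI[of _ _ 0])
  ultimately show ?thesis by blast
qed

text \<open>By uniqueness of coefficients, the leading term appears in every Laurent expansion of u,
  in particular in one with nonnegative coefficients.\<close>

lemma pointed_with_leading_term:
  assumes P: "pointed_with x B u g P"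
    and G: "finite G" "G \<subseteq> carrier_vec m" "u = (\<Sum>h\<in>G. of_int (c h) * laurent_monom x h)"
  shows "g \<in> G \<and> c g = 1"
proof -
  obtain d where d: "u = (\<Sum>h\<in>shift_exponent g ` Poly_Mapping.keys P. of_int (d h) * laurent_monom x h)"
    "g \<in> shift_exponent g ` Poly_Mapping.keys P" "d g = 1"
    using pointed_with_expansion[OF P] by blast
  have "g \<in> carrier_vec m"
    using P by (simp add: pointed_with_def)
  then have "(if g \<in> G then c g else 0) = (if g \<in> shift_exponent g ` Poly_Mapping.keys P then d g else 0)"
    by (intro laurent_coeffs_unique) (use G d shift_exponent_carrier in auto)
  then show ?thesis
    using d by (auto split: if_splits)
qed

text \<open>
  Two g-vectors of the same element lie in each other's cone \<open>g + B \<nat>\<^sup>n\<close>, which is pointed.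
\<close>

lemma pointed_with_unique:
  assumes P: "pointed_with x B u g P" and Q: "pointed_with x B u h Q"
  shows "g = h"
proof -
  have gh: "g \<in> carrier_vec m" "h \<in> carrier_vec m"
    using P Q unfolding pointed_with_def dim by blast+
  obtain c where "u = (\<Sum>k\<in>shift_exponent h ` Poly_Mapping.keys Q. of_int (c k) * laurent_monom x k)"
    using pointed_with_expansion[OF Q] by blast
  then have "g \<in> shift_exponent h ` Poly_Mapping.keys Q"
    using shift_exponent_carrier[OF gh(2)]
    by (intro conjunct1[OF pointed_with_leading_term[OF P finite_imageI[OF finite_keys]]]) auto
  then obtain \<alpha> where \<alpha>: "\<alpha> \<in> Poly_Mapping.keys Q" "g = shift_exponent h \<alpha>" by blast
  obtain d where "u = (\<Sum>k\<in>shift_exponent g ` Poly_Mapping.keys P. of_int (d k) * laurent_monom x k)"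
    using pointed_with_expansion[OF P] by blast
  then have "h \<in> shift_exponent g ` Poly_Mapping.keys P"
    using shift_exponent_carrier[OF gh(1)]
    by (intro conjunct1[OF pointed_with_leading_term[OF Q finite_imageI[OF finite_keys]]]) auto
  then obtain \<beta> where \<beta>: "\<beta> \<in> Poly_Mapping.keys P" "h = shift_exponent g \<beta>" by blast
  let ?v = "\<lambda>\<alpha>. vec n (\<lambda>k. int (Poly_Mapping.lookup \<alpha> k))"
  have h: "g + B *\<^sub>v ?v \<beta> = h" and g: "h + B *\<^sub>v ?v \<alpha> = g"
    unfolding shift_exponent_def[symmetric] by (rule \<beta>(2)[symmetric], rule \<alpha>(2)[symmetric])
  have "g + B *\<^sub>v ?v \<beta> + B *\<^sub>v ?v \<alpha> = g"
    unfolding h by (rule g)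
  then have "B *\<^sub>v ?v \<beta> + B *\<^sub>v ?v \<alpha> = 0\<^sub>v m"
    using gh B_carrier by (auto simp: vec_eq_iff)
  then have "B *\<^sub>v (?v \<beta> + ?v \<alpha>) = 0\<^sub>v m"
    using B_carrier by (subst mult_add_distrib_mat_vec[of _ m n]) auto
  then have "?v \<beta> + ?v \<alpha> = 0\<^sub>v n"
    by (intro B_kernel) auto
  \<comment> \<open>Both summands have nonnegative entries, so each of them vanishes.\<close>
  then have "?v \<alpha> = 0\<^sub>v n"
    by (auto simp: vec_eq_iff)
  then have "B *\<^sub>v ?v \<alpha> = 0\<^sub>v m"
    using B_carrier by (auto simp: scalar_prod_def)
  then show ?thesis
    using g gh by simp
qed

text \<open>Resolves the definite description in \<open>g_vector\<close>: any exponent from a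
  pointed form is the g-vector.\<close>

lemma g_vector_eqI:
  assumes "pointed_with x B u g P"
  shows "g_vector x B u = g"
  unfolding g_vector_def using assms pointed_with_unique by (intro the_equality exI) blast+

lemma pointed_with_mult:
  assumes P: "pointed_with x B u g P" and Q: "pointed_with x B u' g' Q"
  shows "pointed_with x B (u * u') (g + g') (P * Q)"
proof -
  have "mpoly_eval of_int (y_hat x B) (P * Q) = mpoly_eval of_int (y_hat x B) P * mpoly_eval of_int (y_hat x B) Q"
    by (rule mpoly_eval_mult) simp_all
  then show ?thesis
    using P Q by (auto simp: pointed_with_def mpoly_in_mult lookup_mult_zero laurent_monom_add)
qed

end


section \<open>The F-invariant\<close>

locale lambda_cluster =
  fixes m n :: nat and F :: "'a::field_char_0 set" and x :: "nat list \<Rightarrow> 'a vec"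
    and B \<Lambda> :: "nat list \<Rightarrow> int mat"
  assumes pos: "0 < n" and le: "n \<le> m" and lambda: "lambda_upper_cluster_algebra m n F x B \<Lambda>"
begin

section \<open>Local data at the vertices and edges of the tree\<close>

lemma independent_at:
  assumes "t \<in> tree_vertices n"
  shows "independent_vec m (x t)"
proof -
  have "seed m n F (x t, B t)"
    using lambda assms unfolding lambda_upper_cluster_algebra_def cluster_pattern_def by blast
  then show ?thesis
    unfolding seed_def free_generating_set_def prod.case by (intro independent_vec.intro) blast+
qed

lemma compatible_seed_at:
  assumes "t \<in> tree_vertices n"
  shows "\<exists>s. compatible_seed m n (x t) s (B t) (\<Lambda> t)"
proof -
  obtain s where "compatible_pair m n s (B t) (\<Lambda> t)"
    using lambda assms unfolding lambda_upper_cluster_algebra_def by blast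
  then have "compatible_seed m n (x t) s (B t) (\<Lambda> t)"
    using independent_at[OF assms] le by (intro compatible_seed.intro compatible.intro)
  then show ?thesis by (rule exI[of _ s])
qed

lemma tree_edgeD:
  assumes "tree_edge n k t t'"
  shows "t \<in> tree_vertices n" and "t' \<in> tree_vertices n" and "k < n"
  using assms by (auto simp: tree_edge_def tree_vertices_def)

lemma tropical_mutation_at:
  assumes "tree_edge n k t t'"
  shows "\<exists>s \<epsilon>. tropical_mutation m n s (B t) (\<Lambda> t) k \<epsilon> (\<Lambda> t')"
proof -
  obtain \<epsilon> where "\<epsilon> \<in> {1, - 1}" "(B t', \<Lambda> t') = mutate_pair \<epsilon> k (B t, \<Lambda> t)"
    using lambda assms unfolding lambda_upper_cluster_algebra_def by blast
  moreover obtain s where "compatible_seed m n (x t) s (B t) (\<Lambda> t)"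
    using compatible_seed_at[OF tree_edgeD(1)[OF assms]] by (rule exE)
  then have "compatible m n s (B t) (\<Lambda> t)"
    by (rule compatible_seed.axioms(2))
  ultimately have "tropical_mutation m n s (B t) (\<Lambda> t) k \<epsilon> (\<Lambda> t')"
    using tree_edgeD(3)[OF assms]
    by (intro tropical_mutation.intro tropical_mutation_axioms.intro) (simp_all add: mutate_pair_def)
  then show ?thesis
    by (intro exI[of _ s] exI[of _ \<epsilon>])
qed

text \<open>\<open>good\<close> provides some pointed form; by uniqueness its exponent is the one
  named by \<open>g_family\<close>.\<close>

lemma g_family_pointed:
  assumes "good m n x B u" and "t \<in> tree_vertices n"
  shows "\<exists>P. pointed_with (x t) (B t) u (g_family x B u t) P"
proof -
  obtain g P where P: "pointed_with (x t) (B t) u g P"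
    using assms unfolding good_def pointed_def by blast
  obtain s where "compatible_seed m n (x t) s (B t) (\<Lambda> t)"
    using compatible_seed_at[OF assms(2)] by (rule exE)
  then have "g_family x B u t = g"
    unfolding g_family_def by (rule compatible_seed.g_vector_eqI[OF _ P])
  then show ?thesis
    using P by blast
qed

lemma g_family_carrier:
  "good m n x B u \<Longrightarrow> t \<in> tree_vertices n \<Longrightarrow> g_family x B u t \<in> carrier_vec m"
  by (simp add: good_def tropical_point_def)

section \<open>The homomorphism attached to a good element\<close>

abbreviation semifield :: "'a set" where
  "semifield \<equiv> subtraction_free (set\<^sub>v (x []))"

lemma root: "[] \<in> tree_vertices n"
  by (simp add: tree_vertices_def)

lemma root_independent: "independent_vec m (x [])"
  by (rule independent_at[OF root])

lemma Lambda_carrier: "t \<in> tree_vertices n \<Longrightarrow> \<Lambda> t \<in> carrier_mat m m"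
  using lambda by (auto simp: lambda_upper_cluster_algebra_def compatible_pair_def)

text \<open>Applying \<beta> to the exchange relation gives exactly the mutation rule of \<Lambda> g
  from \<open>\<Lambda>_mutated_g\<close>. Agreement at the root therefore spreads over the tree.
  Words list the last edge first, so induction on the list moves away from the root.\<close>

lemma max_plus_hom_tropical_point:
  assumes g: "tropical_point m n B g" and \<beta>: "max_plus_hom semifield \<beta>"
    and init: "\<And>i. i < m \<Longrightarrow> \<beta> (x [] $ i) = (\<Lambda> [] *\<^sub>v g []) $ i"
    and "t \<in> tree_vertices n"
  shows "\<forall>i<m. x t $ i \<in> semifield \<and> \<beta> (x t $ i) = (\<Lambda> t *\<^sub>v g t) $ i"
  using \<open>t \<in> tree_vertices n\<close>
proof (induction t)
  case Nil
  interpret r: independent_vec m "x []" by (rule root_independent)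
  show ?case
    using init by (auto simp: vec_setI intro!: subtraction_free.base)
next
  case (Cons k t)
  interpret r: independent_vec m "x []" by (rule root_independent)
  have t: "t \<in> tree_vertices n" and edge: "tree_edge n k t (k # t)"
    using Cons.prems by (cases t; auto simp: tree_edge_def tree_vertices_def)+
  have IH: "x t $ i \<in> semifield" "\<beta> (x t $ i) = (\<Lambda> t *\<^sub>v g t) $ i" if "i < m" for i
    using Cons.IH[OF t] that by blast+
  obtain s \<epsilon> where "tropical_mutation m n s (B t) (\<Lambda> t) k \<epsilon> (\<Lambda> (k # t))"
    using tropical_mutation_at[OF edge] by blast
  then interpret tropical_mutation m n s "B t" "\<Lambda> t" k \<epsilon> "\<Lambda> (k # t)" .
  have "mutated_g (g t) (g (k # t))"
    using g edge Cons.prems t unfolding tropical_point_def mutated_g_def by blast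
  note r' = \<Lambda>_mutated_g[OF this]
  have dim: "dim_vec (x t) = m"
    using independent_vec.dim[OF independent_at[OF t]] .
  have "m > 0"
    using pos le by simp
  define p where "p c = (\<Prod>j<m. x t $ j powi c j)" for c :: "nat \<Rightarrow> int"
  have p: "p c \<in> semifield" "\<beta> (p c) = (\<Sum>j<m. c j * (\<Lambda> t *\<^sub>v g t) $ j)" for c
    using r.max_plus_hom_prod[OF \<beta> \<open>m > 0\<close> IH(1), of m "\<lambda>i. i" c] IH(2)
    unfolding p_def by simp_all
  let ?b = "\<lambda>j. [B t $$ (j,k)]\<^sub>+" and ?c = "\<lambda>j. [- B t $$ (j,k)]\<^sub>+"
  have x': "x (k # t) $ i = (if i = k then (p ?b + p ?c) / x t $ k else x t $ i)" if "i < m" for i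
  proof -
    have "(x (k # t), B (k # t)) = mutate_seed k (x t, B t)"
      using lambda edge unfolding lambda_upper_cluster_algebra_def cluster_pattern_def by blast
    then show ?thesis
      using that by (simp add: mutate_seed_def dim p_def)
  qed
  show ?case
  proof (intro allI impI)
    fix i assume i: "i < m"
    show "x (k # t) $ i \<in> semifield \<and> \<beta> (x (k # t) $ i) = (\<Lambda> (k # t) *\<^sub>v g (k # t)) $ i"
    proof (cases "i = k")
      case False
      then show ?thesis
        using IH[OF i] r'[OF i] x'[OF i] by simp
    next
      case True
      have sum: "p ?b + p ?c \<in> semifield"
        by (intro subtraction_free.add p)
      have "\<beta> (p ?b + p ?c) = max (\<beta> (p ?b)) (\<beta> (p ?c))"
        using \<beta> p(1) unfolding max_plus_hom_def by blast
      then show ?thesis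
        using True r'[OF i] x'[OF i] IH[OF i] sum r.max_plus_hom_divide[OF \<beta> sum]
        by (simp add: p(2) subtraction_free.divide del: index_mult_mat_vec)
    qed
  qed
qed

text \<open>Resolves the definite description in \<open>beta\<close>. The values of \<Lambda> g at
  the root can be prescribed and propagate to all vertices; they also determine the
  homomorphism.\<close>

lemma beta_characterization:
  assumes "good m n x B u"
  shows "max_plus_hom semifield (beta n x B \<Lambda> u)" (is ?hom)
    and "\<And>t i. t \<in> tree_vertices n \<Longrightarrow> i < m \<Longrightarrow> x t $ i \<in> semifield \<and>
      beta n x B \<Lambda> u (x t $ i) = (\<Lambda> t *\<^sub>v g_family x B u t) $ i"
proof -
  interpret r: independent_vec m "x []" by (rule root_independent)
  let ?g = "g_family x B u"
  let ?Q = "\<lambda>\<beta>. max_plus_hom semifield \<beta> \<and> (\<forall>t\<in>tree_vertices n. map_vec \<beta> (x t) = \<Lambda> t *\<^sub>v ?g t)"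
  have trop: "tropical_point m n B ?g"
    using assms by (simp add: good_def)
  have dim: "dim_vec (x t) = m" if "t \<in> tree_vertices n" for t
    using independent_vec.dim[OF independent_at[OF that]] .
  obtain \<beta> where \<beta>: "max_plus_hom semifield \<beta>" "\<And>i. i < m \<Longrightarrow> \<beta> (x [] $ i) = (\<Lambda> [] *\<^sub>v ?g []) $ i"
    using r.max_plus_hom_exists[OF mult_mat_vec_carrier[OF Lambda_carrier[OF root] g_family_carrier[OF assms root]]]
    by blast
  have beta_vals: "\<forall>i<m. x t $ i \<in> semifield \<and> \<beta> (x t $ i) = (\<Lambda> t *\<^sub>v ?g t) $ i"
    if "t \<in> tree_vertices n" for t
    using trop \<beta> that by (rule max_plus_hom_tropical_point)
  have "map_vec \<beta> (x t) = \<Lambda> t *\<^sub>v ?g t" if "t \<in> tree_vertices n" for t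
    using beta_vals[OF that] carrier_matD(1)[OF Lambda_carrier[OF that]] dim[OF that]
    by (intro eq_vecI) (simp_all del: index_mult_mat_vec)
  then have Q: "?Q \<beta>"
    using \<beta>(1) by blast
  moreover have "\<beta>' = \<beta>" if "?Q \<beta>'" for \<beta>'
  proof (rule r.max_plus_hom_unique)
    fix i assume "i < m"
    moreover have "map_vec \<beta>' (x []) = map_vec \<beta> (x [])"
      using that Q root by simp
    ultimately show "\<beta>' (x [] $ i) = \<beta> (x [] $ i)"
      using dim[OF root] by (metis index_map_vec(1))
  qed (use that \<beta> in auto)
  ultimately have "beta n x B \<Lambda> u = \<beta>"
    unfolding beta_def by (intro the_equality)
  then show ?hom "\<And>t i. t \<in> tree_vertices n \<Longrightarrow> i < m \<Longrightarrow> x t $ i \<in> semifield \<and>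
      beta n x B \<Lambda> u (x t $ i) = (\<Lambda> t *\<^sub>v g_family x B u t) $ i"
    using \<beta>(1) beta_vals by auto
qed

text \<open>
  The leading monomial at \<open>t\<close> occurs with coefficient 1 in a subtraction-free expansion
  of \<open>u\<close>, so its tropical value is a lower bound.
\<close>

lemma beta_lower_bound:
  assumes u: "good m n x B u" and u': "good m n x B u'" and t: "t \<in> tree_vertices n"
  shows "g_family x B u t \<bullet> (\<Lambda> t *\<^sub>v g_family x B u' t) \<le> beta n x B \<Lambda> u' u"
proof -
  interpret r: independent_vec m "x []" by (rule root_independent)
  obtain s where "compatible_seed m n (x t) s (B t) (\<Lambda> t)"
    using compatible_seed_at[OF t] by (rule exE)
  then interpret compatible_seed m n "x t" s "B t" "\<Lambda> t" .
  let ?\<beta> = "beta n x B \<Lambda> u'" and ?g = "g_family x B u t"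
  note \<beta> = beta_characterization[OF u']
  have "u \<in> laurent_polys {0..} (x t)"
    using u t unfolding good_def by blast
  then obtain G c where G: "finite G" "G \<subseteq> carrier_vec m" "\<forall>h\<in>G. 0 \<le> c h"
    "u = (\<Sum>h\<in>G. of_int (c h) * laurent_monom (x t) h)"
    unfolding laurent_polys_def dim by auto
  obtain P where "pointed_with (x t) (B t) u ?g P"
    using g_family_pointed[OF u t] by blast
  from pointed_with_leading_term[OF this G(1,2,4)] have g: "?g \<in> G" "c ?g = 1"
    by simp_all
  \<comment> \<open>Terms with coefficient 0 are dropped, since 0 does not lie in the semifield. The
    leading exponent remains, having coefficient 1.\<close>
  define H where "H = {h \<in> G. c h > 0}"
  have uH: "u = (\<Sum>h\<in>H. of_int (c h) * laurent_monom (x t) h)"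
    unfolding G(4)
  proof (rule sum.mono_neutral_right)
    show "\<forall>h\<in>G - H. of_int (c h) * laurent_monom (x t) h = 0"
    proof
      fix h assume "h \<in> G - H"
      then have "c h = 0"
        using G(3) by (force simp: H_def)
      then show "of_int (c h) * laurent_monom (x t) h = 0" by simp
    qed
  qed (use G(1) in \<open>auto simp: H_def\<close>)
  have monom: "laurent_monom (x t) h \<in> semifield \<and>
      ?\<beta> (laurent_monom (x t) h) = (\<Sum>i<m. h $ i * (\<Lambda> t *\<^sub>v g_family x B u' t) $ i)" for h
    using r.max_plus_hom_prod[OF \<beta>(1), of m "\<lambda>i. x t $ i" "\<lambda>i. h $ i"] \<beta>(2)[OF t] pos le
    by (simp add: laurent_monom_def)
  have term_sf: "of_int (c h) * laurent_monom (x t) h \<in> semifield"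
    and term_val: "?\<beta> (of_int (c h) * laurent_monom (x t) h) = ?\<beta> (laurent_monom (x t) h)" if "h \<in> H" for h
    using max_plus_hom_of_int_mult[OF \<beta>(1) conjunct1[OF monom[of h]], of "c h"] that unfolding H_def by simp_all
  have "?g \<in> H" "finite H"
    using g G(1) by (auto simp: H_def)
  moreover from this have "H \<noteq> {}" by blast
  ultimately have "\<forall>h\<in>H. ?\<beta> (of_int (c h) * laurent_monom (x t) h) \<le> ?\<beta> u"
    unfolding uH by (intro conjunct2[OF max_plus_hom_sum[OF \<beta>(1)]] term_sf)
  then have "?\<beta> (of_int (c ?g) * laurent_monom (x t) ?g) \<le> ?\<beta> u"
    using \<open>?g \<in> H\<close> by blast
  moreover have "\<Lambda> t *\<^sub>v g_family x B u' t \<in> carrier_vec m"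
    by (rule mult_mat_vec_carrier[OF Lambda_carrier[OF t] g_family_carrier[OF u' t]])
  ultimately show ?thesis
    using term_val[OF \<open>?g \<in> H\<close>] monom by (simp add: scalar_prod_sum[of _ m])
qed

text \<open>The two lower bounds are negatives of each other, and the two values they bound sum to
  0, so both bounds are attained. The right-hand side is free of t, so the pairing is constant on
  the tree.\<close>

lemma pairing_eq_beta:
  assumes u: "good m n x B u" and u': "good m n x B u'" and zero: "F_invariant n x B \<Lambda> u u' = 0"
    and t: "t \<in> tree_vertices n"
  shows "g_family x B u t \<bullet> (\<Lambda> t *\<^sub>v g_family x B u' t) = beta n x B \<Lambda> u' u"
proof -
  obtain s where "compatible_seed m n (x t) s (B t) (\<Lambda> t)"
    using compatible_seed_at[OF t] by (rule exE)
  then interpret compatible_seed m n "x t" s "B t" "\<Lambda> t" .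
  have "g_family x B u' t \<bullet> (\<Lambda> t *\<^sub>v g_family x B u t) = - (g_family x B u t \<bullet> (\<Lambda> t *\<^sub>v g_family x B u' t))"
    using u u' t by (intro \<Lambda>_pairing_skew g_family_carrier)
  then show ?thesis
    using beta_lower_bound[OF u u' t] beta_lower_bound[OF u' u t] zero by (simp add: F_invariant_def)
qed

section \<open>Sign-coherence and products of good elements\<close>

lemma tropical_point_mutated_g:
  assumes "tropical_point m n B g" and "tree_edge n k t t'"
  shows "tropical_mutation.mutated_g m (B t) k (g t) (g t')"
proof -
  obtain s \<epsilon> where "tropical_mutation m n s (B t) (\<Lambda> t) k \<epsilon> (\<Lambda> t')"
    using tropical_mutation_at[OF assms(2)] by blast
  then interpret tropical_mutation m n s "B t" "\<Lambda> t" k \<epsilon> "\<Lambda> t'" .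
  show ?thesis
    using assms tree_edgeD[OF assms(2)] unfolding tropical_point_def mutated_g_def by blast
qed

text \<open>If the word starts with k, the neighbour is its parent; otherwise k can be prepended
  without creating equal adjacent letters.\<close>

lemma neighbour_exists:
  assumes "t \<in> tree_vertices n" and "k < n"
  shows "\<exists>t'. tree_edge n k t t'"
proof (cases "\<exists>r. t = k # r")
  case True
  then obtain r where "t = k # r" by blast
  then have "tree_edge n k t r"
    using assms by (cases r) (auto simp: tree_edge_def tree_vertices_def)
  then show ?thesis by blast
next
  case False
  then have "tree_edge n k t (k # t)"
    using assms by (cases t) (auto simp: tree_edge_def tree_vertices_def)
  then show ?thesis by blast
qed

lemma sign_coherent_g_families:
  assumes u: "good m n x B u" and u': "good m n x B u'" and zero: "F_invariant n x B \<Lambda> u u' = 0"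
  shows "sign_coherent n (g_family x B u) (g_family x B u')"
  unfolding sign_coherent_def
proof (intro ballI allI impI)
  fix t k assume t: "t \<in> tree_vertices n" and k: "k < n"
  obtain t' where edge: "tree_edge n k t t'"
    using neighbour_exists[OF t k] by blast
  obtain s \<epsilon> where "tropical_mutation m n s (B t) (\<Lambda> t) k \<epsilon> (\<Lambda> t')"
    using tropical_mutation_at[OF edge] by blast
  then interpret tropical_mutation m n s "B t" "\<Lambda> t" k \<epsilon> "\<Lambda> t'" .
  have "mutated_g (g_family x B u t) (g_family x B u t')" "mutated_g (g_family x B u' t) (g_family x B u' t')"
    using u u' tropical_point_mutated_g[OF _ edge] by (simp_all add: good_def)
  moreover have "g_family x B u t' \<bullet> (\<Lambda> t' *\<^sub>v g_family x B u' t') = g_family x B u t \<bullet> (\<Lambda> t *\<^sub>v g_family x B u' t)"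
    using pairing_eq_beta[OF u u' zero] t tree_edgeD(2)[OF edge] by simp
  ultimately show "g_family x B u t $ k * g_family x B u' t $ k \<ge> 0"
    by (rule sign_coherent_if_pairing_invariant)
qed

text \<open>The mutation rule is linear in g except for [g_k]_+, which is additive on numbers
  without opposite signs. The family f is prescribed only on the tree, where the g-vectors of the
  product are computed.\<close>

lemma tropical_point_add:
  assumes g: "tropical_point m n B g" and h: "tropical_point m n B h" and coh: "sign_coherent n g h"
    and f: "\<And>t. t \<in> tree_vertices n \<Longrightarrow> f t = g t + h t"
  shows "tropical_point m n B f"
  unfolding tropical_point_def
proof (intro conjI ballI allI impI)
  show "f t \<in> carrier_vec m" if "t \<in> tree_vertices n" for t
    using g h f that by (simp add: tropical_point_def)
next
  fix k t t' assume edge: "tree_edge n k t t'"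
  have k: "k < n" "k < m"
    using tree_edgeD(3)[OF edge] le by auto
  have dims: "g t \<in> carrier_vec m" "h t \<in> carrier_vec m" "g t' \<in> carrier_vec m" "h t' \<in> carrier_vec m"
    using g h tree_edgeD[OF edge] by (auto simp: tropical_point_def)
  note ft = f[OF tree_edgeD(1)[OF edge]] f[OF tree_edgeD(2)[OF edge]]
  show "f t' $ k = - f t $ k"
    unfolding ft using g h edge dims k by (simp add: tropical_point_def)
  have "g t $ k * h t $ k \<ge> 0"
    using coh tree_edgeD(1)[OF edge] k by (simp add: sign_coherent_def)
  then have add: "[g t $ k + h t $ k]\<^sub>+ = [g t $ k]\<^sub>+ + [h t $ k]\<^sub>+"
    by (auto simp: pos_part_def zero_le_mult_iff)
  fix i assume "i < m" "i \<noteq> k"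
  then show "f t' $ i = f t $ i + [- B t $$ (i,k)]\<^sub>+ * f t $ k + B t $$ (i,k) * [f t $ k]\<^sub>+"
    unfolding ft using g h edge dims k by (simp add: tropical_point_def add algebra_simps)
qed

text \<open>In a product g-vectors add and F-polynomials multiply at every vertex. Sign-coherence
  enters through the tropical point condition.\<close>

lemma good_mult:
  assumes u: "good m n x B u" and u': "good m n x B u'"
    and coh: "sign_coherent n (g_family x B u) (g_family x B u')"
  shows "good m n x B (u * u')"
proof -
  \<comment> \<open>With C ranging over all integers and over the nonnegative ones, integrality and
    positivity share one argument.\<close>
  have closed: "u * u' \<in> laurent_polys C (x t)"
    if "t \<in> tree_vertices n" "u \<in> laurent_polys C (x t)" "u' \<in> laurent_polys C (x t)" "C = UNIV \<or> C = {0..}" for C t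
    by (rule independent_vec.laurent_polys_mult[OF independent_at[OF that(1)] _ _ _ that(2,3)])
       (use that(4) in auto)
  have pointed: "\<exists>P. pointed_with (x t) (B t) (u * u') (g_family x B u t + g_family x B u' t) P"
    and g: "g_family x B (u * u') t = g_family x B u t + g_family x B u' t" if t: "t \<in> tree_vertices n" for t
  proof -
    obtain s where "compatible_seed m n (x t) s (B t) (\<Lambda> t)"
      using compatible_seed_at[OF t] by (rule exE)
    then interpret compatible_seed m n "x t" s "B t" "\<Lambda> t" .
    obtain P where P: "pointed_with (x t) (B t) u (g_family x B u t) P"
      using g_family_pointed[OF u t] by (rule exE)
    obtain Q where Q: "pointed_with (x t) (B t) u' (g_family x B u' t) Q"
      using g_family_pointed[OF u' t] by (rule exE)
    note PQ = pointed_with_mult[OF P Q]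
    show "\<exists>P. pointed_with (x t) (B t) (u * u') (g_family x B u t + g_family x B u' t) P"
      using PQ by (rule exI[of _ "P * Q"])
    show "g_family x B (u * u') t = g_family x B u t + g_family x B u' t"
      unfolding g_family_def[of x B "u * u'"] by (rule g_vector_eqI[OF PQ])
  qed
  show ?thesis
    unfolding good_def
  proof (intro conjI ballI)
    show "u * u' \<in> upper_cluster_algebra n x"
      unfolding upper_cluster_algebra_def
    proof (rule INT_I)
      fix t assume "t \<in> tree_vertices n"
      moreover from this have "u \<in> laurent_polys UNIV (x t)" "u' \<in> laurent_polys UNIV (x t)"
        using u u' by (simp_all add: good_def upper_cluster_algebra_def)
      ultimately show "u * u' \<in> laurent_polys UNIV (x t)"
        by (rule closed) simp
    qed
    show "pointed (x t) (B t) (u * u')" if "t \<in> tree_vertices n" for t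
      using pointed[OF that] unfolding pointed_def
      by (rule exI[of _ "g_family x B u t + g_family x B u' t"])
    show "tropical_point m n B (g_family x B (u * u'))"
    proof (rule tropical_point_add[OF _ _ coh g])
      show "tropical_point m n B (g_family x B u)" "tropical_point m n B (g_family x B u')"
        using u u' unfolding good_def by simp_all
    qed
    show "u * u' \<in> laurent_polys {0..} (x t)" if "t \<in> tree_vertices n" for t
      using u u' that by (intro closed) (simp_all add: good_def)
  qed
qed

end

theorem theorem1p6:
  fixes m n :: nat
    and F :: "'a::field_char_0 set"
    and x :: "nat list \<Rightarrow> 'a vec"
    and B \<Lambda> :: "nat list \<Rightarrow> int mat"
    and u u' :: 'a
  assumes "0 < n" and "n \<le> m"
    and "lambda_upper_cluster_algebra m n F x B \<Lambda>"
    and "good m n x B u" and "good m n x B u'"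
    and "F_invariant n x B \<Lambda> u u' = 0"
  shows "sign_coherent n (g_family x B u) (g_family x B u') \<and> good m n x B (u * u')"
proof -
  interpret lambda_cluster m n F x B \<Lambda>
    using assms(1-3) by (rule lambda_cluster.intro)
  show ?thesis
    using sign_coherent_g_families[OF assms(4-6)] good_mult[OF assms(4,5)] by blast
qed

end
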